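(* The elements $\alpha^s$ and $\alpha^t$ are non-trivial cycles of $\widehat{\mathsf{dGC}}^{st}_3$ (i.e. they are closed and not in the image of the differential). Furthermore, they represent two different cohomology classes in $H(\widehat{\mathsf{dGC}}^{st}_3)$.
   Context: The base field $\mathbb{K}$ has characteristic zero and differentials have degree $+1$. **The complex $\overline{\mathsf{dGC}}_3$.** It is spanned by connected graphs all of whose vertices are at least trivalent, with four kinds of edges: solid directed edges, dotted $s$-edges, dotted $t$-edges, and wavy edges. A graph with $v$ vertices, $e$ edges in total, $e_1$ dotted edges ($s$- or $t$-edges) and $e_2$ wavy edges has degree $3(v-1)-2e+e_1+2e_2$. Graphs carry an orientation: an ordering of the vertices and an ordering of the dotted edges, a permutation of either acting by its sign (isomorphic graphs are identified accordingly); reversing the direction of a dotted or wavy edge leaves the graph unchanged (the general sign is $(-1)^{k+1}$, here $k=3$). The differential is $d=d_V+d_E$, where $d_V$ splits a vertex into two vertices joined by a new solid directed edge in all ways creating no univalent or bivalent vertices (sign: the source of the new edge takes the place of the old vertex and its target is placed last), and $d_E$ acts on one edge at a time as a degree one derivation (with Koszul signs) by $$d_E(\text{solid})=(t\text{-edge})-(s\text{-edge}),\quad d_E(s\text{-edge})=\text{wavy},\quad d_E(t\text{-edge})=\text{wavy},\quad d_E(\text{wavy})=0.$$ **The complex $\widehat{\mathsf{dGC}}^{st}_3$.** A vertex is a *solid source* if each attached edge is either solid and outgoing or a $t$-edge; it is a *solid target* if each attached edge is either solid and incoming or an $s$-edge. $\overline{\mathsf{dGC}}^{st}_3\subset\overline{\mathsf{dGC}}_3$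 is the subcomplex generated by graphs which have: a solid source and a solid target; or an $s$-edge and a solid target; or a $t$-edge and a solid source; or an $s$-edge and a $t$-edge; or a wavy edge. $\mathsf{Z}_3\subset\overline{\mathsf{dGC}}^{st}_3$ is the subcomplex generated by graphs which have an $s$-edge and a $t$-edge, or an $s$-edge and a wavy edge, or a $t$-edge and a wavy edge, or at least two wavy edges. Put $\widehat{\mathsf{dGC}}^{st}_3=\overline{\mathsf{dGC}}^{st}_3/\mathsf{Z}_3$. **The elements.** Let $\gamma^s$ be the tetrahedron graph with vertices $\tau,m,l,r$, solid edges $\tau\to m$, $m\to l$, $r\to m$, $l\to r$, and two $s$-edges joining $l$ to $\tau$ and $r$ to $\tau$. Let $\gamma^t$ be the tetrahedron graph with vertices $\tau,m,l,r$, solid edges $m\to \tau$, $m\to l$, $r\to m$, $l\to r$, and two $t$-edges joining $l$ to $\tau$ and $r$ to $\tau$. (Fix any orientations.) Both have degree $-1$ and do not lie in $\overline{\mathsf{dGC}}^{st}_3$. Define $\alpha^s$ and $\alpha^t$ as the images of $d\gamma^s$ and $d\gamma^t$ in $\overline{\mathsf{dGC}}_3/\mathsf{Z}_3$; they lie in $\widehat{\mathsf{dGC}}^{st}_3$ in degree $0$. Explicitly, up to signs determined by the orientation conventions, $\alpha^s$ (resp. $\alpha^t$) is the sum of the four graphs obtained from $\gamma^s$ (resp. $\gamma^t$) by replacing one of its four solid edges by an $s$-edge (resp. $t$-edge). *)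

theory Defs
  imports
    Complex_Main
    "HOL-Combinatorics.Permutations"
    "HOL-Library.Multiset"
    "HOL-Library.Poly_Mapping"
    "HOL-Library.Set_Algebras"
begin

section \<open>Oriented graphs\<close>

text \<open>
  A pair \<open>(n, es)\<close> is a graph with vertices \<open>0, \<dots>, n - 1\<close> together with an orientation: the
  vertices are ordered as natural numbers, and the dotted edges are ordered by their position in
  the list \<open>es\<close>. Loops and multiple edges are allowed. An edge \<open>(k, a, b)\<close> of kind \<open>k\<close> runs from
  \<open>a\<close> to \<open>b\<close>; for the kinds other than \<open>Solid\<close> the direction is immaterial, see \<open>relators\<close> below.
\<close>

datatype edge_kind = Solid | SDotted | TDotted | Wavy

type_synonym edge = "edge_kind \<times> nat \<times> nat"
type_synonym graph = "nat \<times> edge list"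

fun dotted :: "edge \<Rightarrow> bool" where
  "dotted (k, a, b) \<longleftrightarrow> k = SDotted \<or> k = TDotted"

definition num_dotted :: "edge list \<Rightarrow> nat" where
  "num_dotted es = length (filter dotted es)"

definition num_kind :: "edge_kind \<Rightarrow> edge list \<Rightarrow> nat" where
  "num_kind k es = length (filter (\<lambda>e. fst e = k) es)"

text \<open>A loop contributes two to the valence of its vertex.\<close>

definition valence :: "edge list \<Rightarrow> nat \<Rightarrow> nat" where
  "valence es x = (\<Sum>(k, a, b)\<leftarrow>es. of_bool (a = x) + of_bool (b = x))"

definition adjacency :: "edge list \<Rightarrow> (nat \<times> nat) set" where
  "adjacency es = {(a, b). \<exists>k. (k, a, b) \<in> set es \<or> (k, b, a) \<in> set es}"

fun admissible :: "graph \<Rightarrow> bool" where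
  "admissible (n, es) \<longleftrightarrow>
     n > 0 \<and>
     (\<forall>(k, a, b) \<in> set es. a < n \<and> b < n) \<and>
     (\<forall>a<n. \<forall>b<n. (a, b) \<in> (adjacency es)\<^sup>*) \<and>
     (\<forall>x<n. valence es x \<ge> 3)"

fun degree :: "graph \<Rightarrow> int" where
  "degree (n, es) =
     3 * (int n - 1) - 2 * int (length es) + int (num_dotted es) + 2 * int (num_kind Wavy es)"


section \<open>Chains\<close>

text \<open>
  Formal linear combinations of oriented graphs. The relations between graphs with different
  orientations are imposed later, by passing to the quotient by \<open>relators\<close>.
\<close>

type_synonym 'k chain = "graph \<Rightarrow>\<^sub>0 'k"

definition smul :: "'k::field_char_0 \<Rightarrow> 'k chain \<Rightarrow> 'k chain" where
  "smul c x = Poly_Mapping.map ((*) c) x"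

definition gr :: "graph \<Rightarrow> 'k::field_char_0 chain" where
  "gr G = Poly_Mapping.single G 1"

lemma lookup_smul [simp]: "Poly_Mapping.lookup (smul c x) G = c * Poly_Mapping.lookup x G"
  by (auto simp: smul_def Poly_Mapping.map.rep_eq when_def)

global_interpretation chain: vector_space "smul :: 'k::field_char_0 \<Rightarrow> 'k chain \<Rightarrow> 'k chain"
  by unfold_locales (auto intro!: poly_mapping_eqI simp: lookup_add algebra_simps)

text \<open>
  The three families of identifications: relabelling the vertices by a permutation acts by its
  sign; interchanging two edges acts by \<open>-1\<close> if both are dotted and trivially otherwise (adjacent
  interchanges generate all permutations of the edges); and dotted and wavy edges may be reversed.
\<close>

definition relators :: "'k::field_char_0 chain set" where
  "relators =
     {gr (n, es) - smul (of_int (sign \<sigma>)) (gr (n, map (\<lambda>(k, a, b). (k, \<sigma> a, \<sigma> b)) es)) | n es \<sigma>.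
        admissible (n, es) \<and> \<sigma> permutes {..<n}} \<union>
     {gr (n, xs @ e # f # ys) -
        smul (if dotted e \<and> dotted f then -1 else 1) (gr (n, xs @ f # e # ys)) | n xs e f ys.
        admissible (n, xs @ e # f # ys)} \<union>
     {gr (n, xs @ (k, a, b) # ys) - gr (n, xs @ (k, b, a) # ys) | n xs k a b ys.
        admissible (n, xs @ (k, a, b) # ys) \<and> k \<noteq> Solid}"


section \<open>The differential\<close>

text \<open>
  \<open>reattachments x y es\<close> lists all ways of moving some of the half-edges at the vertex \<open>x\<close> to the
  vertex \<open>y\<close>. The two half-edges of a loop are moved independently.
\<close>

fun edge_reattachments :: "nat \<Rightarrow> nat \<Rightarrow> edge \<Rightarrow> edge list" where
  "edge_reattachments x y (k, a, b) =
     [(k, a', b'). a' \<leftarrow> (if a = x then [x, y] else [a]), b' \<leftarrow> (if b = x then [x, y] else [b])]"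

definition reattachments :: "nat \<Rightarrow> nat \<Rightarrow> edge list \<Rightarrow> edge list list" where
  "reattachments x y es = product_lists (map (edge_reattachments x y) es)"

text \<open>
  The vertex \<open>x\<close> is split into \<open>x\<close> (the source of the new edge, in the old place) and \<open>n\<close> (its
  target, placed last).
\<close>

fun diff_V :: "graph \<Rightarrow> 'k::field_char_0 chain" where
  "diff_V (n, es) =
     (\<Sum>x<n. \<Sum>fs\<leftarrow>filter (\<lambda>fs. valence fs x \<ge> 3 \<and> valence fs n \<ge> 3)
                    (map (\<lambda>fs. fs @ [(Solid, x, n)]) (reattachments x n es)).
        gr (n + 1, fs))"

text \<open>
  \<open>diff_edge n xs e ys\<close> is the result of applying the differential to the edge \<open>e\<close> in the graph
  \<open>(n, xs @ e # ys)\<close>, without the Koszul sign. In \<open>diff_E\<close>, the sign arises from moving the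
  differential past the \<open>n\<close> vertices, which have odd degree and precede all edges, and past the
  dotted edges that precede \<open>e\<close>; solid and wavy edges have even degree.
\<close>

fun diff_edge :: "nat \<Rightarrow> edge list \<Rightarrow> edge \<Rightarrow> edge list \<Rightarrow> 'k::field_char_0 chain" where
  "diff_edge n xs (Solid, a, b) ys =
     gr (n, xs @ (TDotted, a, b) # ys) - gr (n, xs @ (SDotted, a, b) # ys)"
| "diff_edge n xs (SDotted, a, b) ys = gr (n, xs @ (Wavy, a, b) # ys)"
| "diff_edge n xs (TDotted, a, b) ys = gr (n, xs @ (Wavy, a, b) # ys)"
| "diff_edge n xs (Wavy, a, b) ys = 0"

fun diff_E :: "graph \<Rightarrow> 'k::field_char_0 chain" where
  "diff_E (n, es) =
     (\<Sum>i<length es. smul ((- 1) ^ (n + num_dotted (take i es)))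
        (diff_edge n (take i es) (es ! i) (drop (Suc i) es)))"

definition differential :: "'k::field_char_0 chain \<Rightarrow> 'k chain" where
  "differential x = (\<Sum>G\<in>Poly_Mapping.keys x. smul (Poly_Mapping.lookup x G) (diff_V G + diff_E G))"


section \<open>The complex of sourced and targeted graphs\<close>

text \<open>
  The conditions are imposed on half-edges, so that a solid loop, being both incoming and outgoing,
  prevents its vertex from being a solid source or a solid target.
\<close>

definition solid_source :: "edge list \<Rightarrow> nat \<Rightarrow> bool" where
  "solid_source es x \<longleftrightarrow>
     (\<forall>(k, a, b) \<in> set es. (a = x \<longrightarrow> k = Solid \<or> k = TDotted) \<and> (b = x \<longrightarrow> k = TDotted))"

definition solid_target :: "edge list \<Rightarrow> nat \<Rightarrow> bool" where
  "solid_target es x \<longleftrightarrow>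
     (\<forall>(k, a, b) \<in> set es. (a = x \<longrightarrow> k = SDotted) \<and> (b = x \<longrightarrow> k = Solid \<or> k = SDotted))"

definition has_kind :: "edge_kind \<Rightarrow> edge list \<Rightarrow> bool" where
  "has_kind k es \<longleftrightarrow> (\<exists>a b. (k, a, b) \<in> set es)"

fun st_graph :: "graph \<Rightarrow> bool" where
  "st_graph (n, es) \<longleftrightarrow>
     (\<exists>x<n. solid_source es x) \<and> (\<exists>x<n. solid_target es x) \<or>
     has_kind SDotted es \<and> (\<exists>x<n. solid_target es x) \<or>
     has_kind TDotted es \<and> (\<exists>x<n. solid_source es x) \<or>
     has_kind SDotted es \<and> has_kind TDotted es \<or>
     has_kind Wavy es"

fun Z_graph :: "graph \<Rightarrow> bool" where
  "Z_graph (n, es) \<longleftrightarrow>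
     has_kind SDotted es \<and> has_kind TDotted es \<or>
     has_kind SDotted es \<and> has_kind Wavy es \<or>
     has_kind TDotted es \<and> has_kind Wavy es \<or>
     num_kind Wavy es \<ge> 2"

text \<open>
  \<open>Z3\<close> is the preimage, in the space of all chains, of the subcomplex generated by the graphs
  satisfying \<open>Z_graph\<close>. Since it contains the relators, a quotient by that subcomplex of a complex
  spanned by graphs modulo relators is the same thing as a set of cosets of \<open>Z3\<close>.
\<close>

definition Z3 :: "'k::field_char_0 chain set" where
  "Z3 = chain.span (relators \<union> gr ` {G. admissible G \<and> Z_graph G})"

definition dGC_hat_st :: "'k::field_char_0 chain set set" where
  "dGC_hat_st = (\<lambda>x. x +o Z3) ` chain.span (gr ` {G. admissible G \<and> st_graph G})"

definition dGC_hat_st_deg :: "int \<Rightarrow> 'k::field_char_0 chain set set" where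
  "dGC_hat_st_deg p =
     (\<lambda>x. x +o Z3) ` chain.span (gr ` {G. admissible G \<and> st_graph G \<and> degree G = p})"

text \<open>
  The induced differential sends the coset of \<open>x\<close> to the coset of \<open>differential x\<close>; it is written here
  without a choice of representatives, using elementwise addition of sets. Likewise \<open>+\<close> of two
  cosets is their sum in the quotient, and \<open>X +o boundaries\<close> is the cohomology class of \<open>X\<close>.
\<close>

definition diff_hat :: "'k::field_char_0 chain set \<Rightarrow> 'k chain set" where
  "diff_hat X = differential ` X + Z3"

definition cycles :: "'k::field_char_0 chain set set" where
  "cycles = {X \<in> dGC_hat_st. diff_hat X = Z3}"

definition boundaries :: "'k::field_char_0 chain set set" where
  "boundaries = diff_hat ` dGC_hat_st"

definition cohomology_class :: "'k::field_char_0 chain set \<Rightarrow> 'k chain set set" where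
  "cohomology_class X = X +o boundaries"


section \<open>The two tetrahedra\<close>

text \<open>
  All labellings of the vertices and all orderings of the edges are admitted, which amounts to all
  choices of orientation.
\<close>

definition is_gamma_s :: "graph \<Rightarrow> bool" where
  "is_gamma_s G \<longleftrightarrow> (\<exists>\<tau> m l r es.
     distinct [\<tau>, m, l, r] \<and> {\<tau>, m, l, r} = {..<4} \<and> G = (4, es) \<and>
     mset es = {#(Solid, \<tau>, m), (Solid, m, l), (Solid, r, m), (Solid, l, r),
                 (SDotted, l, \<tau>), (SDotted, r, \<tau>)#})"

definition is_gamma_t :: "graph \<Rightarrow> bool" where
  "is_gamma_t G \<longleftrightarrow> (\<exists>\<tau> m l r es.
     distinct [\<tau>, m, l, r] \<and> {\<tau>, m, l, r} = {..<4} \<and> G = (4, es) \<and>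
     mset es = {#(Solid, m, \<tau>), (Solid, m, l), (Solid, r, m), (Solid, l, r),
                 (TDotted, l, \<tau>), (TDotted, r, \<tau>)#})"

text \<open>The image of \<open>d \<gamma>\<close> in the quotient by the subcomplex \<open>Z3\<close>.\<close>

definition alpha :: "graph \<Rightarrow> 'k::field_char_0 chain set" where
  "alpha \<gamma> = differential (gr \<gamma>) +o Z3"

end

theory Submission
  imports Defs
begin

text \<open>
  Closedness. All vertices of the two tetrahedra \<open>\<gamma>\<close> are trivalent, and splitting such a vertex creates a
  vertex of valence less than three. So \<open>d\<close> acts on \<open>\<gamma>\<close>, and on the graphs in \<open>d \<gamma>\<close>, by \<open>d\<^sub>E\<close> alone, which
  squares to zero (\<open>differential_diff_E\<close>). The graphs in \<open>d \<gamma>\<close> belong to the subcomplex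
  (\<open>st_graph_replace\<close>). Passing to cosets requires that the differential maps \<open>Z3\<close>, and in
  particular the changes of orientation, to \<open>Z3\<close> (\<open>differential_Z3\<close>).

  Nontriviality. For either kind \<open>k\<close> of dotted edges there is a cocycle on the dual side, the
  function \<open>weight k\<close>, supported on tetrahedra with three solid edges and three edges of kind \<open>k\<close>. Let the
  marked end of a solid edge be its tail for s-edges and its head for t-edges, and let \<open>u\<^sub>1, u\<^sub>2, u\<^sub>3\<close> be the
  unit vectors in four-space belonging to the marked ends of the solid edges. The weight is the product of
  \<open>det (u\<^sub>1, u\<^sub>2, u\<^sub>3, (1, 1, 1, 1))\<close> and of the sign of the ordering of the six edges. It respects orientations
  because a transposition of the vertices of a tetrahedron induces an even permutation of its edges
  (\<open>weight_relabel\<close>). It is a cocycle on the subcomplex for two reasons: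

  \<^item> The weight of a graph with three vertices, after splitting a vertex \<open>x\<close>, is zero: if any
    term is nonzero, some other vertex is joined to \<open>x\<close> by two edges whose ends at \<open>x\<close> may be exchanged,
    which cancels the terms in pairs (\<open>parallel_pair\<close>, \<open>total_split_weight_parallel\<close>).
  \<^item> On a tetrahedron with four solid edges and two edges of kind \<open>k\<close>, expanding a determinant shows
    that \<open>d\<^sub>E\<close> has weight \<open>\<plusminus>4 det (u\<^sub>1, u\<^sub>2, u\<^sub>3, u\<^sub>4)\<close> (\<open>pairing_diff_E_tetrahedron\<close>). This is zero if some
    vertex is no marked end, hence for graphs of the subcomplex, which have a solid target or a solid source
    (\<open>pairing_differential_st_graph\<close>).

  In \<open>\<gamma>\<close> every vertex is the marked end of exactly one solid edge, so that the weight of \<open>d \<gamma>\<close> is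
  \<open>\<plusminus>4\<close> and \<open>d \<gamma>\<close> is not a boundary in the subcomplex. Finally, \<open>weight SDotted\<close> vanishes on \<open>\<alpha>\<^sup>t\<close> but
  not on \<open>\<alpha>\<^sup>s\<close>, and this separates the two classes.
\<close>

section \<open>Linear extension from graphs to chains\<close>

lemma linear_extension:
  fixes s :: "'k::field_char_0 \<Rightarrow> 'v::ab_group_add \<Rightarrow> 'v"
  assumes "vector_space s"
  shows "Vector_Spaces.linear smul s
           (\<lambda>x. \<Sum>G\<in>Poly_Mapping.keys x. s (Poly_Mapping.lookup x G) (f G))"
proof -
  interpret s: vector_space s by fact
  let ?F = "\<lambda>x. \<Sum>G\<in>Poly_Mapping.keys x. s (Poly_Mapping.lookup x G) (f G)"
  have wider: "?F x = (\<Sum>G\<in>A. s (Poly_Mapping.lookup x G) (f G))"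
    if "finite A" "Poly_Mapping.keys x \<subseteq> A" for A and x :: "'k chain"
    using that by (intro sum.mono_neutral_left) (auto simp: in_keys_iff)
  show ?thesis
  proof unfold_locales
    fix x y :: "'k chain" and c :: 'k
    let ?A = "Poly_Mapping.keys x \<union> Poly_Mapping.keys y \<union> Poly_Mapping.keys (x + y)"
    show "?F (x + y) = ?F x + ?F y"
      by (subst (1 2 3) wider[of ?A]) (auto simp: lookup_add s.scale_left_distrib sum.distrib)
    let ?B = "Poly_Mapping.keys x \<union> Poly_Mapping.keys (smul c x)"
    show "?F (smul c x) = s c (?F x)"
      by (subst (1 2) wider[of ?B]) (auto simp: s.scale_sum_right)
  qed
qed

lemma linear_differential: "Vector_Spaces.linear smul smul differential"
  using linear_extension[OF chain.vector_space_axioms, of "\<lambda>G. diff_V G + diff_E G"]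
  by (simp add: differential_def[abs_def])

interpretation differential: Vector_Spaces.linear smul smul "differential :: 'k::field_char_0 chain \<Rightarrow> 'k chain"
  by (rule linear_differential)

lemma differential_gr: "differential (gr G) = diff_V G + diff_E G"
  by (simp add: differential_def gr_def)

definition pairing :: "(graph \<Rightarrow> int) \<Rightarrow> 'k::field_char_0 chain \<Rightarrow> 'k" where
  "pairing w x = (\<Sum>G\<in>Poly_Mapping.keys x. Poly_Mapping.lookup x G * of_int (w G))"

interpretation pairing: Vector_Spaces.linear smul "(*)" "pairing w :: 'k::field_char_0 chain \<Rightarrow> 'k"
  unfolding pairing_def[abs_def]
  by (rule linear_extension, unfold_locales) (auto simp: algebra_simps)

lemma pairing_gr [simp]: "pairing w (gr G) = of_int (w G)"
  by (simp add: pairing_def gr_def)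

lemma sum_list_hom:
  assumes "f 0 = 0" "\<And>x y. f (x + y) = f x + f y"
  shows "f (sum_list xs) = (\<Sum>x\<leftarrow>xs. f x)"
  using assms by (induction xs) auto


section \<open>Equality of chains modulo changes of orientation\<close>

definition orient_equiv :: "'k::field_char_0 chain \<Rightarrow> 'k chain \<Rightarrow> bool" (infix "\<approx>" 50) where
  "x \<approx> y \<longleftrightarrow> x - y \<in> chain.span relators"

lemma orient_refl [simp]: "x \<approx> x"
  by (simp add: orient_equiv_def chain.span_zero)

lemma orient_eq_trans [trans]: "x \<approx> y \<Longrightarrow> y = z \<Longrightarrow> x \<approx> z"
  and eq_orient_trans [trans]: "x = y \<Longrightarrow> y \<approx> z \<Longrightarrow> x \<approx> z"
  by simp_all

lemma orient_add: "x \<approx> y \<Longrightarrow> x' \<approx> y' \<Longrightarrow> x + x' \<approx> y + y'"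
  unfolding orient_equiv_def using chain.span_add[of "x - y" relators "x' - y'"] by (simp add: algebra_simps)

lemma orient_scale: "x \<approx> y \<Longrightarrow> smul c x \<approx> smul c y"
  unfolding orient_equiv_def using chain.span_scale[of "x - y" relators c]
  by (simp add: chain.scale_right_diff_distrib)

lemma orient_diff: "x \<approx> y \<Longrightarrow> x' \<approx> y' \<Longrightarrow> x - x' \<approx> y - y'"
  unfolding orient_equiv_def using chain.span_diff[of "x - y" relators "x' - y'"] by (simp add: algebra_simps)

lemma orient_sum: "(\<And>i. i \<in> A \<Longrightarrow> f i \<approx> g i) \<Longrightarrow> sum f A \<approx> sum g A"
  by (induction A rule: infinite_finite_induct) (auto intro: orient_add)

lemma orient_sum_list: "(\<And>i. i \<in> set xs \<Longrightarrow> f i \<approx> g i) \<Longrightarrow> sum_list (map f xs) \<approx> sum_list (map g xs)"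
  by (induction xs) (auto intro: orient_add)

definition relabel :: "(nat \<Rightarrow> nat) \<Rightarrow> edge list \<Rightarrow> edge list" where
  "relabel \<sigma> es = map (\<lambda>(k, a, b). (k, \<sigma> a, \<sigma> b)) es"

definition swap_sign :: "edge \<Rightarrow> edge \<Rightarrow> 'k::field_char_0" where
  "swap_sign e f = (if dotted e \<and> dotted f then -1 else 1)"

lemma orient_relabel:
  "admissible (n, es) \<Longrightarrow> \<sigma> permutes {..<n} \<Longrightarrow>
     gr (n, es) \<approx> smul (of_int (sign \<sigma>)) (gr (n, relabel \<sigma> es))"
  unfolding orient_equiv_def relabel_def relators_def by (rule chain.span_base) blast

lemma orient_swap:
  "admissible (n, xs @ e # f # ys) \<Longrightarrow>
     gr (n, xs @ e # f # ys) \<approx> smul (swap_sign e f) (gr (n, xs @ f # e # ys))"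
  unfolding orient_equiv_def swap_sign_def relators_def by (rule chain.span_base) blast

lemma orient_reverse:
  "admissible (n, xs @ (k, a, b) # ys) \<Longrightarrow> k \<noteq> Solid \<Longrightarrow>
     gr (n, xs @ (k, a, b) # ys) \<approx> gr (n, xs @ (k, b, a) # ys)"
  unfolding orient_equiv_def relators_def by (rule chain.span_base) blast

lemma relatorE:
  assumes "x \<in> relators"
  obtains (relabel) n es \<sigma> where "admissible (n, es)" "\<sigma> permutes {..<n}"
      "x = gr (n, es) - smul (of_int (sign \<sigma>)) (gr (n, relabel \<sigma> es))"
  | (swap) n xs e f ys where "admissible (n, xs @ e # f # ys)"
      "x = gr (n, xs @ e # f # ys) - smul (swap_sign e f) (gr (n, xs @ f # e # ys))"
  | (reverse) n xs k a b ys where "admissible (n, xs @ (k, a, b) # ys)" "k \<noteq> Solid"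
      "x = gr (n, xs @ (k, a, b) # ys) - gr (n, xs @ (k, b, a) # ys)"
  using assms unfolding relators_def relabel_def swap_sign_def by blast


section \<open>Splitting a vertex preserves admissibility\<close>

text \<open>
  Admissibility ignores the kinds of the edges, hence is preserved by the edge differential.
\<close>

lemma admissible_cong_ends:
  assumes "map snd es = map snd es'"
  shows "admissible (n, es) \<longleftrightarrow> admissible (n, es')"
proof -
  have ends: "(\<exists>k. (k, p) \<in> set es) \<longleftrightarrow> (\<exists>k. (k, p) \<in> set es')" for p
  proof -
    have "(\<exists>k. (k, p) \<in> set xs) \<longleftrightarrow> p \<in> set (map snd xs)" for xs :: "edge list"
      by force
    with assms show ?thesis by metis
  qed
  have "adjacency es = adjacency es'"
    unfolding adjacency_def ex_disj_distrib ends ..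
  moreover have "valence es x = valence es' x" for x
  proof -
    have "valence xs x = (\<Sum>(a, b)\<leftarrow>map snd xs. of_bool (a = x) + of_bool (b = x))" for xs :: "edge list"
      by (induction xs) (auto simp: valence_def)
    with assms show ?thesis by metis
  qed
  moreover have "(\<forall>(k, a, b)\<in>set es. a < n \<and> b < n) \<longleftrightarrow> (\<forall>(k, a, b)\<in>set es'. a < n \<and> b < n)"
    using ends by fast
  ultimately show ?thesis by simp
qed

lemma reattachments_Nil [simp]: "reattachments x y [] = [[]]"
  by (simp add: reattachments_def)

lemma set_reattachments:
  "set (reattachments x y es) = {fs. list_all2 (\<lambda>f e. f \<in> set (edge_reattachments x y e)) fs es}"
  by (simp add: reattachments_def product_lists_set list_all2_map2)

lemma edge_reattachmentsD:
  assumes "(k', a', b') \<in> set (edge_reattachments x y (k, a, b))"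
  shows "k' = k" "a' = a \<or> a' = y \<and> a = x" "b' = b \<or> b' = y \<and> b = x"
  using assms by (auto split: if_splits)

lemma reattachments_fst:
  assumes "fs \<in> set (reattachments x y es)" shows "map fst fs = map fst es"
proof -
  from assms have "list_all2 (\<lambda>f e. f \<in> set (edge_reattachments x y e)) fs es"
    by (simp add: set_reattachments)
  then show ?thesis
    by (induction rule: list_all2_induct) (auto split: if_splits)
qed

lemma valence_Cons: "valence ((k, a, b) # es) z = of_bool (a = z) + of_bool (b = z) + valence es z"
  by (simp add: valence_def)

lemma reattachments_valence:
  assumes "fs \<in> set (reattachments x n es)" and "\<forall>(k, a, b)\<in>set es. a < n \<and> b < n" and "x < n"
  shows "z \<noteq> x \<Longrightarrow> z \<noteq> n \<Longrightarrow> valence fs z = valence es z"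
    and "valence fs x + valence fs n = valence es x"
proof -
  from assms have "list_all2 (\<lambda>f e. f \<in> set (edge_reattachments x n e)) fs es"
    by (simp add: set_reattachments)
  then have "(z \<noteq> x \<longrightarrow> z \<noteq> n \<longrightarrow> valence fs z = valence es z) \<and> valence fs x + valence fs n = valence es x"
    using assms(2)
  proof (induction rule: list_all2_induct)
    case Nil
    show ?case by (simp add: valence_def)
  next
    case (Cons f fs e es)
    obtain k a b where e: "e = (k, a, b)" by (cases e) auto
    obtain k' a' b' where f: "f = (k', a', b')" by (cases f) auto
    from Cons.prems \<open>x < n\<close> have less: "a \<noteq> n" "b \<noteq> n" "x \<noteq> n" by (auto simp: e)
    have IH: "z \<noteq> x \<Longrightarrow> z \<noteq> n \<Longrightarrow> valence fs z = valence es z"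
      "valence fs x + valence fs n = valence es x"
      using Cons.IH Cons.prems by auto
    note f' = edge_reattachmentsD[OF Cons.hyps(1)[unfolded e f]]
    have "valence (f # fs) z = valence (e # es) z" if "z \<noteq> x" "z \<noteq> n"
      using IH(1)[OF that] that f'(2,3) by (auto simp: valence_Cons e f)
    moreover have "of_bool (a' = x) + of_bool (a' = n) = (of_bool (a = x) :: nat)"
      "of_bool (b' = x) + of_bool (b' = n) = (of_bool (b = x) :: nat)"
      using f'(2,3) less by auto
    then have "valence (f # fs) x + valence (f # fs) n = valence (e # es) x"
      using IH(2) unfolding valence_Cons e f by linarith
    ultimately show ?case by blast
  qed
  then show "z \<noteq> x \<Longrightarrow> z \<noteq> n \<Longrightarrow> valence fs z = valence es z"
    and "valence fs x + valence fs n = valence es x" by auto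
qed

lemma valence_append: "valence (xs @ ys) z = valence xs z + valence ys z"
  by (simp add: valence_def)

text \<open>
  Connectedness survives because the split graph contracts to the old one: every old edge lifts to an
  edge between the same vertices up to replacing \<open>x\<close> by \<open>n\<close>, and \<open>x\<close> and \<open>n\<close> are joined by the
  new edge.
\<close>

lemma admissible_split:
  assumes adm: "admissible (n, es)" and fs: "fs \<in> set (reattachments x n es)" and x: "x < n"
    and val: "valence (fs @ [(Solid, x, n)]) x \<ge> 3" "valence (fs @ [(Solid, x, n)]) n \<ge> 3"
  shows "admissible (n + 1, fs @ [(Solid, x, n)])"
proof -
  let ?fs = "fs @ [(Solid, x, n)]"
  from fs have all2: "list_all2 (\<lambda>f e. f \<in> set (edge_reattachments x n e)) fs es"
    by (simp add: set_reattachments)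
  have range: "\<forall>(k, a, b)\<in>set es. a < n \<and> b < n" using adm by simp
  have "\<forall>(k, a, b)\<in>set fs. a < n + 1 \<and> b < n + 1"
    using all2 range
  proof (induction rule: list_all2_induct)
    case (Cons f fs e es)
    then show ?case using x by (cases f; cases e) (auto split: if_splits)
  qed auto
  then have range': "\<forall>(k, a, b)\<in>set ?fs. a < n + 1 \<and> b < n + 1" using x by auto
  have sym: "(b, a) \<in> (adjacency ?fs)\<^sup>*" if "(a, b) \<in> (adjacency ?fs)\<^sup>*" for a b
  proof -
    have "sym (adjacency ?fs)" by (auto simp: sym_def adjacency_def)
    then have "sym ((adjacency ?fs)\<^sup>*)" by (rule sym_rtrancl)
    with that show ?thesis by (simp add: symD)
  qed
  have new: "(x, n) \<in> adjacency ?fs" "(n, x) \<in> adjacency ?fs" by (auto simp: adjacency_def)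
  have lift: "(a, b) \<in> (adjacency ?fs)\<^sup>*" if "(k, a, b) \<in> set es" for k a b
  proof -
    from all2 that obtain f where f: "f \<in> set fs" "f \<in> set (edge_reattachments x n (k, a, b))"
      by (metis list_all2_conv_all_nth in_set_conv_nth)
    obtain k' a' b' where f_eq: "f = (k', a', b')" by (cases f) auto
    note f' = edge_reattachmentsD[OF f(2)[unfolded f_eq]]
    have "(a', b') \<in> adjacency ?fs" using f(1) by (auto simp: adjacency_def f_eq)
    moreover have "(a, a') \<in> (adjacency ?fs)\<^sup>*" using f'(2) new by auto
    moreover have "(b', b) \<in> (adjacency ?fs)\<^sup>*" using f'(3) new by auto
    ultimately show ?thesis by (meson rtrancl.rtrancl_into_rtrancl rtrancl_trans)
  qed
  have old: "(a, b) \<in> (adjacency ?fs)\<^sup>*" if "a < n" "b < n" for a b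
  proof -
    from adm that have "(a, b) \<in> (adjacency es)\<^sup>*" by simp
    then show ?thesis
    proof induction
      case (step u v)
      then have "(u, v) \<in> (adjacency ?fs)\<^sup>*" using lift sym by (auto simp: adjacency_def[of es])
      with step show ?case by simp
    qed simp
  qed
  have to_x: "(a, x) \<in> (adjacency ?fs)\<^sup>*" if "a < n + 1" for a
    using that old[of a x] new x by (cases "a = n") auto
  have "(a, b) \<in> (adjacency ?fs)\<^sup>*" if "a < n + 1" "b < n + 1" for a b
    using to_x[OF that(1)] sym[OF to_x[OF that(2)]] by (rule rtrancl_trans)
  moreover have "valence ?fs z \<ge> 3" if "z < n + 1" for z
  proof (cases "z = x \<or> z = n")
    case False
    then have "valence fs z = valence es z" using reattachments_valence(1)[OF fs range x] by auto
    moreover have "valence es z \<ge> 3" using adm that False by simp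
    ultimately show ?thesis by (simp add: valence_append)
  qed (use val in auto)
  ultimately show ?thesis using range' by simp
qed


declare admissible.simps [simp del] diff_V.simps [simp del] diff_E.simps [simp del]

section \<open>The differential is compatible with changes of orientation\<close>

text \<open>
  One summand of the vertex differential. Keeping the valence condition inside the summand turns
  the filtered sum into a sum over all reattachments, which factors along concatenation of edge lists.
\<close>

definition split_term :: "nat \<Rightarrow> nat \<Rightarrow> edge list \<Rightarrow> 'k::field_char_0 chain" where
  "split_term n x fs =
     (if valence (fs @ [(Solid, x, n)]) x \<ge> 3 \<and> valence (fs @ [(Solid, x, n)]) n \<ge> 3
      then gr (Suc n, fs @ [(Solid, x, n)]) else 0)"

lemma diff_V_split_term:
  "diff_V (n, es) = (\<Sum>x<n. \<Sum>fs\<leftarrow>reattachments x n es. split_term n x fs)"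
  by (simp add: diff_V.simps split_term_def sum_list_map_filter' comp_def)

lemma sum_list_map_concat:
  "(\<Sum>x\<leftarrow>concat xss. (g x :: 'a::comm_monoid_add)) = (\<Sum>xs\<leftarrow>xss. \<Sum>x\<leftarrow>xs. g x)"
  by (induction xss) auto

lemma sum_list_reattachments_Cons:
  "(\<Sum>fs\<leftarrow>reattachments x y (e # es). (g fs :: 'a::comm_monoid_add)) =
     (\<Sum>f\<leftarrow>edge_reattachments x y e. \<Sum>fs\<leftarrow>reattachments x y es. g (f # fs))"
  by (simp add: reattachments_def sum_list_map_concat comp_def)

lemma sum_list_reattachments_append:
  "(\<Sum>fs\<leftarrow>reattachments x y (es @ es'). (g fs :: 'a::comm_monoid_add)) =
     (\<Sum>fs\<leftarrow>reattachments x y es. \<Sum>fs'\<leftarrow>reattachments x y es'. g (fs @ fs'))"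
  by (induction es arbitrary: g) (simp_all add: sum_list_reattachments_Cons)

lemma sum_list_smul: "(\<Sum>x\<leftarrow>xs. smul c (f x)) = smul c (\<Sum>x\<leftarrow>xs. f x)"
  by (induction xs) (auto simp: chain.scale_right_distrib)

lemma sum_list_swap:
  "(\<Sum>x\<leftarrow>xs. \<Sum>y\<leftarrow>ys. (f x y :: 'a::comm_monoid_add)) = (\<Sum>y\<leftarrow>ys. \<Sum>x\<leftarrow>xs. f x y)"
  by (induction xs) (auto simp: sum_list_addf)

lemma valence_swap: "valence (xs @ e # f # ys) z = valence (xs @ f # e # ys) z"
  by (simp add: valence_def)

lemma valence_reverse: "valence (xs @ (k, a, b) # ys) z = valence (xs @ (k, b, a) # ys) z"
  by (simp add: valence_def)

lemma relabel_append [simp]: "relabel \<sigma> (xs @ ys) = relabel \<sigma> xs @ relabel \<sigma> ys"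
  and relabel_Cons [simp]: "relabel \<sigma> ((k, a, b) # ys) = (k, \<sigma> a, \<sigma> b) # relabel \<sigma> ys"
  and relabel_Nil [simp]: "relabel \<sigma> [] = []"
  and relabel_id [simp]: "relabel id xs = xs"
  by (auto simp: relabel_def case_prod_beta)

lemma valence_relabel: "inj \<sigma> \<Longrightarrow> valence (relabel \<sigma> es) (\<sigma> z) = valence es z"
  by (induction es) (auto simp: valence_def relabel_def inj_eq)

lemma reattachments_relabel:
  assumes "inj \<sigma>"
  shows "reattachments (\<sigma> x) (\<sigma> y) (relabel \<sigma> es) = map (relabel \<sigma>) (reattachments x y es)"
proof (induction es)
  case (Cons e es)
  obtain k a b where e: "e = (k, a, b)" by (cases e) auto
  have "edge_reattachments (\<sigma> x) (\<sigma> y) (k, \<sigma> a, \<sigma> b) =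
      map (\<lambda>(k, a, b). (k, \<sigma> a, \<sigma> b)) (edge_reattachments x y (k, a, b))"
    using assms by (auto simp: inj_eq)
  moreover have "reattachments u v (f # fs) =
      concat (map (\<lambda>f. map ((#) f) (reattachments u v fs)) (edge_reattachments u v f))" for u v f fs
    by (simp add: reattachments_def)
  ultimately show ?case
    using Cons by (simp add: e map_concat comp_def relabel_def case_prod_beta del: edge_reattachments.simps)
qed simp

text \<open>
  Splitting commutes literally with relabelling, the list of reattachments included; the sign of
  \<open>\<sigma>\<close> is unchanged when \<open>\<sigma>\<close> is extended to the new, last vertex by fixing it.
\<close>

lemma diff_V_relabel:
  assumes adm: "admissible (n, es)" and \<sigma>: "\<sigma> permutes {..<n}"
  shows "diff_V (n, es) \<approx> smul (of_int (sign \<sigma>)) (diff_V (n, relabel \<sigma> es))"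
proof -
  let ?s = "of_int (sign \<sigma>)"
  have inj: "inj \<sigma>" and fix_n: "\<sigma> n = n" using \<sigma> permutes_inj permutes_not_in by fastforce+
  have \<sigma>': "\<sigma> permutes {..<n + 1}" by (rule permutes_subset[OF \<sigma>]) auto
  have term_eq: "split_term n x fs \<approx> smul ?s (split_term n (\<sigma> x) (relabel \<sigma> fs))"
    if "x < n" "fs \<in> set (reattachments x n es)" for x fs
  proof -
    have "valence (relabel \<sigma> fs @ [(Solid, \<sigma> x, n)]) (\<sigma> z) = valence (fs @ [(Solid, x, n)]) z" for z
      using valence_relabel[OF inj, of "fs @ [(Solid, x, n)]" z] by (simp add: fix_n)
    from this[of x] this[of n] show ?thesis
      using orient_relabel[OF admissible_split[OF adm that(2,1)] \<sigma>']
      by (auto simp add: split_term_def fix_n)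
  qed
  have "diff_V (n, es) \<approx>
      (\<Sum>x<n. \<Sum>fs\<leftarrow>reattachments x n es. smul ?s (split_term n (\<sigma> x) (relabel \<sigma> fs)))"
    unfolding diff_V_split_term by (intro orient_sum orient_sum_list term_eq) auto
  also have "\<dots> = smul ?s (\<Sum>x<n. \<Sum>fs\<leftarrow>reattachments (\<sigma> x) n (relabel \<sigma> es). split_term n (\<sigma> x) fs)"
    using reattachments_relabel[OF inj, of _ n es]
    by (simp add: sum_list_smul chain.scale_sum_right fix_n comp_def)
  also have "(\<Sum>x<n. \<Sum>fs\<leftarrow>reattachments (\<sigma> x) n (relabel \<sigma> es). split_term n (\<sigma> x) fs)
      = diff_V (n, relabel \<sigma> es)"
    unfolding diff_V_split_term
    using sum.permute[OF \<sigma>, of "\<lambda>x. \<Sum>fs\<leftarrow>reattachments x n (relabel \<sigma> es). split_term n x fs"]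
    unfolding comp_def by (rule sym)
  finally show ?thesis .
qed

lemma reattached_kind: "f \<in> set (edge_reattachments x y e) \<Longrightarrow> fst f = fst e"
  by (cases e; cases f) (auto split: if_splits)

lemma dotted_iff: "dotted e \<longleftrightarrow> fst e = SDotted \<or> fst e = TDotted"
  by (cases e) auto

lemma reattachments_appendI:
  "fs \<in> set (reattachments x y es) \<Longrightarrow> gs \<in> set (reattachments x y es') \<Longrightarrow>
     fs @ gs \<in> set (reattachments x y (es @ es'))"
  by (simp add: set_reattachments list_all2_appendI)

lemma reattachments_ConsI:
  "f \<in> set (edge_reattachments x y e) \<Longrightarrow> fs \<in> set (reattachments x y es) \<Longrightarrow>
     f # fs \<in> set (reattachments x y (e # es))"
  by (simp add: set_reattachments)

text \<open>
  Reattaching half-edges does not change kinds, and the new edge is solid, so that each summand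
  picks up the same sign as the original graph.
\<close>

lemma diff_V_swap:
  assumes adm: "admissible (n, xs @ e # f # ys)"
  shows "diff_V (n, xs @ e # f # ys) \<approx> smul (swap_sign e f) (diff_V (n, xs @ f # e # ys))"
proof -
  let ?s = "swap_sign e f :: 'a" and ?R = "reattachments"
  have term_eq: "split_term n x (us @ e' # f' # vs) \<approx> smul ?s (split_term n x (us @ f' # e' # vs))"
    if "x < n" "us \<in> set (?R x n xs)" "e' \<in> set (edge_reattachments x n e)"
      "f' \<in> set (edge_reattachments x n f)" "vs \<in> set (?R x n ys)" for x us e' f' vs
  proof -
    have mem: "us @ e' # f' # vs \<in> set (?R x n (xs @ e # f # ys))"
      using that by (intro reattachments_appendI reattachments_ConsI) auto
    have "swap_sign e' f' = (?s :: 'a)"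
      using that reattached_kind by (simp add: swap_sign_def dotted_iff)
    with orient_swap[where ?'a = 'a, of "n + 1" us e' f' "vs @ [(Solid, x, n)]"] admissible_split[OF adm mem that(1)]
    show ?thesis
      by (auto simp add: split_term_def valence_swap[of us e'])
  qed
  have "diff_V (n, xs @ e # f # ys) =
      (\<Sum>x<n. \<Sum>us\<leftarrow>?R x n xs. \<Sum>e'\<leftarrow>edge_reattachments x n e. \<Sum>f'\<leftarrow>edge_reattachments x n f.
         \<Sum>vs\<leftarrow>?R x n ys. split_term n x (us @ e' # f' # vs))"
    unfolding diff_V_split_term sum_list_reattachments_append sum_list_reattachments_Cons ..
  also have "\<dots> \<approx>
      (\<Sum>x<n. \<Sum>us\<leftarrow>?R x n xs. \<Sum>e'\<leftarrow>edge_reattachments x n e. \<Sum>f'\<leftarrow>edge_reattachments x n f.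
         \<Sum>vs\<leftarrow>?R x n ys. smul ?s (split_term n x (us @ f' # e' # vs)))"
    by (intro orient_sum orient_sum_list term_eq) auto
  also have "\<dots> = smul ?s
      (\<Sum>x<n. \<Sum>us\<leftarrow>?R x n xs. \<Sum>f'\<leftarrow>edge_reattachments x n f. \<Sum>e'\<leftarrow>edge_reattachments x n e.
         \<Sum>vs\<leftarrow>?R x n ys. split_term n x (us @ f' # e' # vs))"
    by (subst sum_list_swap[where xs = "edge_reattachments _ n e"])
      (simp add: sum_list_smul chain.scale_sum_right del: edge_reattachments.simps)
  also have "\<dots> = smul ?s (diff_V (n, xs @ f # e # ys))"
    unfolding diff_V_split_term sum_list_reattachments_append sum_list_reattachments_Cons ..
  finally show ?thesis .
qed

lemma sum_list_edge_reattachments_reverse: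
  "(\<Sum>e\<leftarrow>edge_reattachments x y (k, a, b). (g (case e of (k, a, b) \<Rightarrow> (k, b, a)) :: 'a::comm_monoid_add)) =
     (\<Sum>e\<leftarrow>edge_reattachments x y (k, b, a). g e)"
  by (auto simp: ac_simps)

lemma diff_V_reverse:
  assumes adm: "admissible (n, xs @ (k, a, b) # ys)" and k: "k \<noteq> Solid"
  shows "(diff_V (n, xs @ (k, a, b) # ys) :: 'k::field_char_0 chain) \<approx> diff_V (n, xs @ (k, b, a) # ys)"
proof -
  let ?R = "reattachments"
  have term_eq: "(split_term n x (us @ e # vs) :: 'k chain) \<approx> split_term n x (us @ (case e of (k, a, b) \<Rightarrow> (k, b, a)) # vs)"
    if "x < n" "us \<in> set (?R x n xs)" "e \<in> set (edge_reattachments x n (k, a, b))"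
      "vs \<in> set (?R x n ys)" for x us e vs
  proof -
    have mem: "us @ e # vs \<in> set (?R x n (xs @ (k, a, b) # ys))"
      using that by (intro reattachments_appendI reattachments_ConsI) auto
    have "fst e = k" using reattached_kind[OF that(3)] by simp
    then obtain a' b' where e: "e = (k, a', b')" by (cases e) auto
    from orient_reverse[where ?'a = 'k, of "n + 1" us k a' b' "vs @ [(Solid, x, n)]"] admissible_split[OF adm mem that(1)] k
    show ?thesis
      by (auto simp add: split_term_def e valence_reverse[of us k a' b'])
  qed
  have "(diff_V (n, xs @ (k, a, b) # ys) :: 'k chain) =
      (\<Sum>x<n. \<Sum>us\<leftarrow>?R x n xs. \<Sum>e\<leftarrow>edge_reattachments x n (k, a, b).
         \<Sum>vs\<leftarrow>?R x n ys. split_term n x (us @ e # vs))"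
    unfolding diff_V_split_term sum_list_reattachments_append sum_list_reattachments_Cons ..
  also have "\<dots> \<approx>
      (\<Sum>x<n. \<Sum>us\<leftarrow>?R x n xs. \<Sum>e\<leftarrow>edge_reattachments x n (k, a, b).
         \<Sum>vs\<leftarrow>?R x n ys. split_term n x (us @ (case e of (k, a, b) \<Rightarrow> (k, b, a)) # vs))"
    by (intro orient_sum orient_sum_list term_eq) auto
  also have "\<dots> = 
      (\<Sum>x<n. \<Sum>us\<leftarrow>?R x n xs. \<Sum>e\<leftarrow>edge_reattachments x n (k, b, a).
         \<Sum>vs\<leftarrow>?R x n ys. split_term n x (us @ e # vs))"
    by (subst sum_list_edge_reattachments_reverse
        [where g = "\<lambda>e. \<Sum>vs\<leftarrow>?R _ n ys. split_term n _ (_ @ e # vs)"]) (rule refl)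
  also have "\<dots> = diff_V (n, xs @ (k, b, a) # ys)"
    unfolding diff_V_split_term sum_list_reattachments_append sum_list_reattachments_Cons ..
  finally show ?thesis .
qed

text \<open>
  The part of the edge differential that acts on the segment \<open>zs\<close> of the list \<open>xs @ zs @ ys\<close>.
  Splitting a list into segments isolates the one or two edges that a change of orientation moves.
\<close>

fun diff_segment :: "nat \<Rightarrow> edge list \<Rightarrow> edge list \<Rightarrow> edge list \<Rightarrow> 'k::field_char_0 chain" where
  "diff_segment n xs [] ys = 0"
| "diff_segment n xs (e # zs) ys =
     smul ((- 1) ^ (n + num_dotted xs)) (diff_edge n xs e (zs @ ys)) + diff_segment n (xs @ [e]) zs ys"

lemma diff_segment_sum:
  "diff_segment n xs zs ys =
     (\<Sum>i<length zs. smul ((- 1) ^ (n + num_dotted (xs @ take i zs)))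
        (diff_edge n (xs @ take i zs) (zs ! i) (drop (Suc i) zs @ ys)))"
proof (induction zs arbitrary: xs)
  case (Cons e zs)
  show ?case by (simp add: Cons sum.lessThan_Suc_shift del: sum.lessThan_Suc)
qed simp

lemma diff_E_segment: "diff_E (n, es) = diff_segment n [] es []"
  by (simp add: diff_E.simps diff_segment_sum)

lemma diff_segment_append:
  "diff_segment n xs (zs @ zs') ys = diff_segment n xs zs (zs' @ ys) + diff_segment n (xs @ zs) zs' ys"
  by (induction zs arbitrary: xs) (simp_all add: algebra_simps)

lemma diff_edge_cong:
  assumes "\<And>k. gr (n, xs @ (k, a, b) # ys) \<approx> smul c (gr (n, xs' @ (k, a', b') # ys'))"
  shows "diff_edge n xs (k, a, b) ys \<approx> smul c (diff_edge n xs' (k, a', b') ys')"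
  using assms by (cases k) (simp_all add: chain.scale_right_diff_distrib orient_diff)

lemma num_dotted_append [simp]: "num_dotted (xs @ ys) = num_dotted xs + num_dotted ys"
  and num_dotted_Cons [simp]: "num_dotted (e # ys) = of_bool (dotted e) + num_dotted ys"
  and num_dotted_Nil [simp]: "num_dotted [] = 0"
  by (simp_all add: num_dotted_def)

text \<open>
  An identification of graphs that leaves the kinds in the segment \<open>zs\<close> free passes to the
  differential of that segment, because the differential only changes these kinds.
\<close>

lemma diff_segment_cong:
  assumes "num_dotted xs = num_dotted xs'"
    and "\<And>z. map snd z = map snd zs \<Longrightarrow>
           gr (n, xs @ z @ ys) \<approx> smul c (gr (n, xs' @ relabel \<sigma> z @ ys'))"
  shows "diff_segment n xs zs ys \<approx> smul c (diff_segment n xs' (relabel \<sigma> zs) ys')"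
  using assms
proof (induction zs arbitrary: xs xs')
  case (Cons e zs)
  obtain k a b where e: "e = (k, a, b)" by (cases e) auto
  have "diff_edge n xs e (zs @ ys) \<approx> smul c (diff_edge n xs' (k, \<sigma> a, \<sigma> b) (relabel \<sigma> zs @ ys'))"
    unfolding e
  proof (rule diff_edge_cong)
    fix k
    show "gr (n, xs @ (k, a, b) # zs @ ys) \<approx> smul c (gr (n, xs' @ (k, \<sigma> a, \<sigma> b) # relabel \<sigma> zs @ ys'))"
      using Cons.prems(2)[of "(k, a, b) # zs"] by (simp add: e)
  qed
  moreover have "diff_segment n (xs @ [e]) zs ys \<approx>
      smul c (diff_segment n (xs' @ [(k, \<sigma> a, \<sigma> b)]) (relabel \<sigma> zs) ys')"
  proof (rule Cons.IH)
    show "num_dotted (xs @ [e]) = num_dotted (xs' @ [(k, \<sigma> a, \<sigma> b)])"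
      using Cons.prems(1) by (simp add: e)
    fix z :: "edge list" assume "map snd z = map snd zs"
    then show "gr (n, (xs @ [e]) @ z @ ys) \<approx>
        smul c (gr (n, (xs' @ [(k, \<sigma> a, \<sigma> b)]) @ relabel \<sigma> z @ ys'))"
      using Cons.prems(2)[of "e # z"] by (simp add: e)
  qed
  ultimately have "smul ((- 1) ^ (n + num_dotted xs)) (diff_edge n xs e (zs @ ys)) +
        diff_segment n (xs @ [e]) zs ys \<approx>
      smul ((- 1) ^ (n + num_dotted xs)) (smul c (diff_edge n xs' (k, \<sigma> a, \<sigma> b) (relabel \<sigma> zs @ ys'))) +
        smul c (diff_segment n (xs' @ [(k, \<sigma> a, \<sigma> b)]) (relabel \<sigma> zs) ys')"
    by (intro orient_add orient_scale)
  then show ?case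
    using Cons.prems(1) by (simp add: e chain.scale_right_distrib mult.commute)
qed simp

lemma diff_E_relabel:
  assumes adm: "admissible (n, es)" and \<sigma>: "\<sigma> permutes {..<n}"
  shows "diff_E (n, es) \<approx> smul (of_int (sign \<sigma>)) (diff_E (n, relabel \<sigma> es))"
  unfolding diff_E_segment
proof (rule diff_segment_cong)
  fix z :: "edge list" assume "map snd z = map snd es"
  then have "admissible (n, z)" using adm admissible_cong_ends by blast
  then show "gr (n, [] @ z @ []) \<approx> smul (of_int (sign \<sigma>)) (gr (n, [] @ relabel \<sigma> z @ []))"
    using orient_relabel[OF _ \<sigma>] by simp
qed simp

lemma diff_segment_cong_id:
  assumes "num_dotted xs = num_dotted xs'"
    and "\<And>z. map snd z = map snd zs \<Longrightarrow> gr (n, xs @ z @ ys) \<approx> smul c (gr (n, xs' @ z @ ys'))"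
  shows "diff_segment n xs zs ys \<approx> smul c (diff_segment n xs' zs ys')"
  using diff_segment_cong[of xs xs' zs n ys c id ys'] assms by simp

lemma admissible_change_kind:
  "admissible (n, xs @ (k, a, b) # ys) \<longleftrightarrow> admissible (n, xs @ (k', a, b) # ys)"
  by (rule admissible_cong_ends) simp

text \<open>
  Outside the two edges the sign is that of the swap. On the two edges, the differential changes the
  parity of the edge it acts on, which changes the sign of the swap exactly if the other edge is
  dotted; this is compensated by the Koszul sign for passing that other edge.
\<close>

lemma diff_E_swap:
  assumes adm: "admissible (n, xs @ e # f # ys)"
  shows "diff_E (n, xs @ e # f # ys) \<approx> smul (swap_sign e f) (diff_E (n, xs @ f # e # ys))"
proof -
  let ?s = "swap_sign e f :: 'a"
  have adm': "admissible (n, zs)" if "map snd zs = map snd (xs @ e # f # ys)" for zs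
    using that adm admissible_cong_ends by blast
  have left: "diff_segment n [] xs (e # f # ys) \<approx> smul ?s (diff_segment n [] xs (f # e # ys))"
    by (rule diff_segment_cong_id) (auto intro!: orient_swap adm')
  have right: "diff_segment n (xs @ [e, f]) ys [] \<approx> smul ?s (diff_segment n (xs @ [f, e]) ys [])"
  proof (rule diff_segment_cong_id)
    fix z :: "edge list" assume "map snd z = map snd ys"
    then have "gr (n, xs @ e # f # z) \<approx> smul ?s (gr (n, xs @ f # e # z))"
      by (intro orient_swap adm') simp
    then show "gr (n, (xs @ [e, f]) @ z @ []) \<approx> smul ?s (gr (n, (xs @ [f, e]) @ z @ []))" by simp
  qed simp
  obtain k a b where e: "e = (k, a, b)" by (cases e) auto
  obtain k' a' b' where f: "f = (k', a', b')" by (cases f) auto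
  have sw_e: "gr (n, xs @ (l, a, b) # f # ys) \<approx>
      smul (swap_sign (l, a, b) f :: 'a) (gr (n, xs @ f # (l, a, b) # ys))" for l
    by (intro orient_swap adm') (simp add: e)
  have sw_f: "gr (n, xs @ e # (l, a', b') # ys) \<approx>
      smul (swap_sign e (l, a', b') :: 'a) (gr (n, xs @ (l, a', b') # e # ys))" for l
    by (intro orient_swap adm') (simp add: f)
  have mid_e: "diff_edge n xs e (f # ys) \<approx>
      smul (?s * (- 1) ^ of_bool (dotted f)) (diff_edge n (xs @ [f]) e ys)"
    using orient_diff[OF sw_e[of TDotted] sw_e[of SDotted]] sw_e[of Wavy]
    by (cases k; cases "dotted f") (auto simp: e swap_sign_def chain.scale_right_diff_distrib)
  have mid_f: "diff_edge n (xs @ [e]) f ys \<approx>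
      smul (?s * (- 1) ^ of_bool (dotted e)) (diff_edge n xs f (e # ys))"
    using orient_diff[OF sw_f[of TDotted] sw_f[of SDotted]] sw_f[of Wavy]
    by (cases k'; cases "dotted e") (auto simp: f swap_sign_def chain.scale_right_diff_distrib)
  let ?p = "(- 1) ^ (n + num_dotted xs) :: 'a"
  have mid_e': "smul ?p (diff_edge n xs e (f # ys)) \<approx>
      smul ?s (smul ((- 1) ^ (n + num_dotted (xs @ [f]))) (diff_edge n (xs @ [f]) e ys))"
  proof -
    have "?p * (?s * (- 1) ^ of_bool (dotted f)) = ?s * (- 1) ^ (n + num_dotted (xs @ [f]))"
      by (simp add: power_add)
    with orient_scale[OF mid_e, of ?p] show ?thesis by (simp only: chain.scale_scale)
  qed
  have mid_f': "smul ((- 1) ^ (n + num_dotted (xs @ [e]))) (diff_edge n (xs @ [e]) f ys) \<approx>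
      smul ?s (smul ?p (diff_edge n xs f (e # ys)))"
  proof -
    have "(- 1) ^ (n + num_dotted (xs @ [e])) * (?s * (- 1) ^ of_bool (dotted e)) = ?s * ?p"
      by (cases "dotted e") (simp_all add: power_add)
    with orient_scale[OF mid_f, of "(- 1) ^ (n + num_dotted (xs @ [e]))"] show ?thesis
      by (simp only: chain.scale_scale)
  qed
  have expand: "diff_E (n, xs @ g # h # ys) = diff_segment n [] xs (g # h # ys) +
      (smul ?p (diff_edge n xs g (h # ys)) +
       smul ((- 1) ^ (n + num_dotted (xs @ [g]))) (diff_edge n (xs @ [g]) h ys)) +
      diff_segment n (xs @ [g, h]) ys []" for g h
    by (simp add: diff_E_segment diff_segment_append add.assoc)
  show ?thesis
    unfolding expand chain.scale_right_distrib
    using orient_add[OF orient_add[OF left orient_add[OF mid_e' mid_f']] right]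
    by (simp only: add.commute[of "smul ?s (smul ?p (diff_edge n xs f (e # ys)))"])
qed

lemma diff_E_reverse:
  assumes adm: "admissible (n, xs @ (k, a, b) # ys)" and k: "k \<noteq> Solid"
  shows "diff_E (n, xs @ (k, a, b) # ys) \<approx> diff_E (n, xs @ (k, b, a) # ys)"
proof -
  have adm': "admissible (n, zs)" if "map snd zs = map snd (xs @ (k, a, b) # ys)" for zs
    using that adm admissible_cong_ends by blast
  have rev: "gr (n, us @ (l, a, b) # vs) \<approx> smul 1 (gr (n, us @ (l, b, a) # vs))"
    if "map snd us = map snd xs" "map snd vs = map snd ys" "l \<noteq> Solid" for us vs l
    using that by (simp, intro orient_reverse adm') simp_all
  have left: "diff_segment n [] xs ((k, a, b) # ys) \<approx> smul 1 (diff_segment n [] xs ((k, b, a) # ys))"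
    by (rule diff_segment_cong_id) (use rev k in auto)
  have right: "diff_segment n (xs @ [(k, a, b)]) ys [] \<approx> smul 1 (diff_segment n (xs @ [(k, b, a)]) ys [])"
    by (rule diff_segment_cong_id) (use rev k in auto)
  have mid: "diff_edge n xs (k, a, b) ys \<approx> diff_edge n xs (k, b, a) ys"
    using k rev[of xs ys Wavy] by (cases k) auto
  show ?thesis
    using orient_add[OF left orient_add[OF orient_scale[OF mid] right]]
    by (simp add: diff_E_segment diff_segment_append)
qed

lemma differential_relators:
  assumes "x \<in> relators"
  shows "differential x \<in> chain.span relators"
  using assms
proof (cases rule: relatorE)
  case (relabel n es \<sigma>)
  then show ?thesis
    using orient_add[OF diff_V_relabel diff_E_relabel, of n es \<sigma>]
    by (simp add: differential.diff differential.scale differential_gr orient_equiv_def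
        chain.scale_right_distrib)
next
  case (swap n xs e f ys)
  then show ?thesis
    using orient_add[OF diff_V_swap diff_E_swap, of n xs e f ys]
    by (simp add: differential.diff differential.scale differential_gr orient_equiv_def
        chain.scale_right_distrib)
next
  case (reverse n xs k a b ys)
  then show ?thesis
    using orient_add[OF diff_V_reverse diff_E_reverse, of n xs k a b ys]
    by (simp add: differential.diff differential_gr orient_equiv_def)
qed


section \<open>Stability of \<open>Z3\<close> under the differential\<close>

lemma has_kind_iff: "has_kind k es \<longleftrightarrow> k \<in> fst ` set es"
  by (force simp: has_kind_def)

lemma num_kind_count: "num_kind k es = count_list (map fst es) k"
  by (induction es) (auto simp: num_kind_def)

lemma Z_graph_split:
  assumes "Z_graph (n, es)" and "map fst fs = map fst es"
  shows "Z_graph (m, fs @ [(Solid, x, y)])"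
proof -
  have "fst ` set fs = fst ` set es" using assms(2) by (metis list.set_map)
  with assms show ?thesis by (auto simp: has_kind_iff num_kind_count)
qed

lemma gr_Z3: "admissible G \<Longrightarrow> Z_graph G \<Longrightarrow> gr G \<in> Z3"
  unfolding Z3_def by (rule chain.span_base) auto

lemma Z3_zero: "0 \<in> Z3" and Z3_add: "x \<in> Z3 \<Longrightarrow> y \<in> Z3 \<Longrightarrow> x + y \<in> Z3"
  and Z3_diff: "x \<in> Z3 \<Longrightarrow> y \<in> Z3 \<Longrightarrow> x - y \<in> Z3" and Z3_scale: "x \<in> Z3 \<Longrightarrow> smul c x \<in> Z3"
  and Z3_sum: "(\<And>i. i \<in> A \<Longrightarrow> f i \<in> Z3) \<Longrightarrow> sum f A \<in> Z3"
  unfolding Z3_def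
  by (auto intro: chain.span_zero chain.span_add chain.span_diff chain.span_scale chain.span_sum)

lemma diff_V_Z_graph:
  assumes "admissible (n, es)" and "Z_graph (n, es)"
  shows "(diff_V (n, es) :: 'k::field_char_0 chain) \<in> Z3"
proof -
  have "(split_term n x fs :: 'k chain) \<in> Z3" if "x < n" "fs \<in> set (reattachments x n es)" for x fs
    using admissible_split[OF assms(1) that(2,1)] Z_graph_split[OF assms(2) reattachments_fst[OF that(2)]]
    by (auto simp: split_term_def Z3_zero intro!: gr_Z3)
  moreover have "sum_list ts \<in> Z3" if "set ts \<subseteq> Z3" for ts :: "'k chain list"
    using that by (induction ts) (auto simp: Z3_zero Z3_add)
  ultimately show ?thesis
    unfolding diff_V_split_term by (intro Z3_sum) (auto simp: image_subset_iff)
qed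

text \<open>
  The differential of an edge can only remove a dotted edge by making it wavy, and in the presence of a
  second edge of the kinds in question the result is again one of the forbidden combinations.
\<close>

lemma diff_edge_Z_graph:
  assumes "admissible (n, xs @ e # ys)" and "Z_graph (n, xs @ e # ys)"
  shows "diff_edge n xs e ys \<in> Z3"
proof -
  obtain k a b where e: "e = (k, a, b)" by (cases e) auto
  have adm: "admissible (n, xs @ (l, a, b) # ys)" for l
    using assms(1) admissible_change_kind unfolding e by blast
  have kind: "has_kind l (xs @ (l', a, b) # ys) \<longleftrightarrow> has_kind l (xs @ ys) \<or> l = l'"
    and num: "num_kind l (xs @ (l', a, b) # ys) = num_kind l (xs @ ys) + of_bool (l = l')" for l l'
    by (auto simp: has_kind_def num_kind_def)
  have wavy: "has_kind Wavy (xs @ ys) \<Longrightarrow> 1 \<le> num_kind Wavy (xs @ ys)"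
    by (force simp: has_kind_def num_kind_def Suc_le_eq filter_empty_conv)
  have "Z_graph (n, xs @ (l, a, b) # ys)" if "k = Solid \<or> k \<in> {SDotted, TDotted} \<and> l = Wavy" for l
    using assms(2) that wavy unfolding e Z_graph.simps kind num by (cases k) auto
  then show ?thesis
    unfolding e by (cases k) (simp_all add: Z3_zero Z3_diff gr_Z3 adm)
qed

lemma diff_E_Z_graph:
  assumes "admissible (n, es)" and "Z_graph (n, es)"
  shows "diff_E (n, es) \<in> Z3"
  unfolding diff_E.simps
proof (intro Z3_sum Z3_scale)
  fix i assume "i \<in> {..<length es}"
  then have "es = take i es @ es ! i # drop (Suc i) es" by (simp add: id_take_nth_drop)
  with assms show "diff_edge n (take i es) (es ! i) (drop (Suc i) es) \<in> Z3"
    by (metis diff_edge_Z_graph)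
qed

lemma differential_Z3:
  assumes "x \<in> Z3" shows "differential x \<in> Z3"
  using assms unfolding Z3_def
proof (induction rule: chain.span_induct)
  case base
  show ?case
    by (auto simp: chain.subspace_def differential.add differential.scale differential.zero
        intro: chain.span_zero chain.span_add chain.span_scale)
next
  case (step x)
  then show ?case
  proof
    assume "x \<in> relators"
    then show ?thesis
      using differential_relators chain.span_mono[of relators "relators \<union> gr ` {G. admissible G \<and> Z_graph G}"]
      by blast
  next
    assume "x \<in> gr ` {G. admissible G \<and> Z_graph G}"
    then obtain n es where "admissible (n, es)" "Z_graph (n, es)" "x = gr (n, es)" by auto
    then show ?thesis
      using Z3_add[OF diff_V_Z_graph diff_E_Z_graph] by (simp add: Z3_def differential_gr)
  qed
qed


section \<open>The edge differential squares to zero\<close>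

text \<open>
  The differential of a single edge, as a list of coefficients and kinds. Indexing the terms in this
  way makes the two orders of acting on a pair of edges directly comparable.
\<close>

fun boundary_kinds :: "edge_kind \<Rightarrow> ('k::field_char_0 \<times> edge_kind) list" where
  "boundary_kinds Solid = [(1, TDotted), (- 1, SDotted)]"
| "boundary_kinds SDotted = [(1, Wavy)]"
| "boundary_kinds TDotted = [(1, Wavy)]"
| "boundary_kinds Wavy = []"

definition set_kind :: "edge list \<Rightarrow> nat \<Rightarrow> edge_kind \<Rightarrow> edge list" where
  "set_kind es i k = es[i := (k, snd (es ! i))]"

definition koszul_sign :: "nat \<Rightarrow> edge list \<Rightarrow> nat \<Rightarrow> 'k::field_char_0" where
  "koszul_sign n es i = (- 1) ^ (n + num_dotted (take i es))"

lemma diff_E_boundary_kinds: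
  "(diff_E (n, es) :: 'k::field_char_0 chain) = (\<Sum>i<length es. \<Sum>p\<leftarrow>boundary_kinds (fst (es ! i)).
     smul (koszul_sign n es i * fst p) (gr (n, set_kind es i (snd p))))"
proof -
  have "(diff_edge n (take i es) (es ! i) (drop (Suc i) es) :: 'k chain) =
      (\<Sum>p\<leftarrow>boundary_kinds (fst (es ! i)). smul (fst p) (gr (n, set_kind es i (snd p))))"
    if "i < length es" for i
    using that by (cases "es ! i"; cases "fst (es ! i)") (auto simp: set_kind_def upd_conv_take_nth_drop)
  then show ?thesis
    by (simp add: diff_E.simps koszul_sign_def sum_list_smul[symmetric])
qed

lemma num_dotted_set_kind:
  assumes "i < length es" and "dotted (k, a, b) \<noteq> dotted (es ! i)"
  shows "(- 1 :: 'k::field_char_0) ^ num_dotted (set_kind es i k) = - ((- 1) ^ num_dotted es)"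
proof -
  have "num_dotted es = num_dotted (take i es @ es ! i # drop (Suc i) es)"
    using assms(1) by (simp add: id_take_nth_drop[symmetric])
  then show ?thesis
    using assms by (cases "dotted (es ! i)")
      (auto simp: set_kind_def upd_conv_take_nth_drop dotted_iff power_add)
qed

lemma boundary_kinds_parity:
  "(c, k) \<in> set (boundary_kinds (fst e)) \<Longrightarrow> dotted (k, a, b) \<noteq> dotted e"
  by (cases e; cases "fst e") auto

text \<open>
  The differential of an edge is odd: it flips the signs of all later edges and of no earlier one.
\<close>

lemma koszul_sign_set_kind:
  assumes "i < length es" "j < length es" "(c, k) \<in> set (boundary_kinds (fst (es ! i)))"
  shows "koszul_sign n (set_kind es i k) j = (if i < j then - 1 else 1) * (koszul_sign n es j :: 'k::field_char_0)"
proof (cases "i < j")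
  case True
  have "take j (set_kind es i k) = set_kind (take j es) i k"
    using True by (simp add: set_kind_def take_update_swap)
  moreover have "dotted (k, undefined, undefined) \<noteq> dotted (take j es ! i)"
    using boundary_kinds_parity[OF assms(3)] True by simp
  ultimately show ?thesis
    using True assms num_dotted_set_kind[where ?'k = 'k, of i "take j es" k undefined undefined]
    by (simp add: koszul_sign_def power_add)
next
  case False
  then show ?thesis by (simp add: koszul_sign_def set_kind_def)
qed

lemma sum_list_uminus: "(\<Sum>x\<leftarrow>xs. - (f x :: 'a::ab_group_add)) = - (\<Sum>x\<leftarrow>xs. f x)"
  by (induction xs) auto

lemma antisymmetric_sum_zero:
  fixes A :: "nat \<Rightarrow> nat \<Rightarrow> 'k::field_char_0 chain"
  assumes "\<And>i j. i < n \<Longrightarrow> j < n \<Longrightarrow> A i j = - A j i"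
  shows "(\<Sum>i<n. \<Sum>j<n. A i j) = 0"
proof -
  have "(\<Sum>i<n. \<Sum>j<n. A i j) = (\<Sum>i<n. \<Sum>j<n. - A j i)"
    by (intro sum.cong refl assms) simp_all
  also have "\<dots> = - (\<Sum>i<n. \<Sum>j<n. A i j)"
    by (subst sum.swap) (simp add: sum_negf)
  finally have "smul 2 (\<Sum>i<n. \<Sum>j<n. A i j) = 0"
    using chain.scale_left_distrib[of "1 :: 'k" 1] by (simp add: add_eq_0_iff)
  then show ?thesis by simp
qed

text \<open>
  In the double sum over pairs of edges, the two orders of acting on distinct edges give the same graph
  with opposite signs, while acting twice on a solid edge gives \<open>Wavy - Wavy\<close>.
\<close>

lemma differential_diff_E:
  assumes "\<And>fs. map snd fs = map snd es \<Longrightarrow> diff_V (n, fs) = (0 :: 'k::field_char_0 chain)"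
  shows "differential (diff_E (n, es)) = (0 :: 'k chain)"
proof -
  let ?bk = "\<lambda>es i. boundary_kinds (fst (es ! i)) :: ('k \<times> edge_kind) list"
  define B :: "nat \<Rightarrow> nat \<Rightarrow> 'k \<times> edge_kind \<Rightarrow> 'k \<times> edge_kind \<Rightarrow> 'k chain" where
    "B i j p q = smul (koszul_sign n es i * fst p * (koszul_sign n (set_kind es i (snd p)) j * fst q))
       (gr (n, set_kind (set_kind es i (snd p)) j (snd q)))" for i j p q
  define A where "A i j = (\<Sum>p\<leftarrow>?bk es i. \<Sum>q\<leftarrow>?bk (set_kind es i (snd p)) j. B i j p q)" for i j
  have ends: "map snd (set_kind es i k) = map snd es" if "i < length es" for i k
    using that list_update_id[of "map snd es" i] by (simp add: set_kind_def map_update)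
  have "differential (gr (n, set_kind es i k)) = (diff_E (n, set_kind es i k) :: 'k chain)"
    if "i < length es" for i k
    using assms[OF ends[OF that]] by (simp add: differential_gr)
  then have "differential (diff_E (n, es)) =
      (\<Sum>i<length es. \<Sum>p\<leftarrow>?bk es i. smul (koszul_sign n es i * fst p) (diff_E (n, set_kind es i (snd p))))"
    unfolding diff_E_boundary_kinds[of n es]
    by (simp add: differential.sum sum_list_hom[of differential] differential.zero differential.add
        differential.scale case_prod_beta comp_def)
  also have "\<dots> = (\<Sum>i<length es. \<Sum>p\<leftarrow>?bk es i. \<Sum>j<length es.
      \<Sum>q\<leftarrow>?bk (set_kind es i (snd p)) j. B i j p q)"
    unfolding diff_E_boundary_kinds B_def
    by (simp add: chain.scale_sum_right sum_list_smul[symmetric] case_prod_beta set_kind_def)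
  also have "\<dots> = (\<Sum>i<length es. \<Sum>j<length es. A i j)"
  proof -
    have "(\<Sum>p\<leftarrow>ps. \<Sum>j<m. (h p j :: 'k chain)) = (\<Sum>j<m. \<Sum>p\<leftarrow>ps. h p j)" for ps :: "('k \<times> edge_kind) list" and m :: nat and h
      by (induction ps) (simp_all add: sum.distrib)
    then show ?thesis by (simp add: A_def)
  qed
  also have "\<dots> = 0"
  proof (rule antisymmetric_sum_zero)
    fix i j assume ij: "i < length es" "j < length es"
    consider "i = j" | "i \<noteq> j" by blast
    then show "A i j = - A j i"
    proof cases
      case 1
      have "koszul_sign n (set_kind es i k) i = (koszul_sign n es i :: 'k)" for k
        by (simp add: koszul_sign_def set_kind_def)
      then have "A i i = 0"
        using ij by (cases "fst (es ! i)") (auto simp: A_def B_def set_kind_def)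
      with 1 show ?thesis by simp
    next
      case 2
      have other: "?bk (set_kind es i k) j = ?bk es j" "?bk (set_kind es j k) i = ?bk es i" for k
        using 2 by (simp_all add: set_kind_def)
      have "B i j p q = - B j i q p" if "p \<in> set (?bk es i)" "q \<in> set (?bk es j)" for p q
      proof -
        have eq1: "set_kind (set_kind es i (snd p)) j (snd q) = set_kind (set_kind es j (snd q)) i (snd p)"
          using 2 by (simp add: set_kind_def list_update_swap)
        have eq2: "koszul_sign n (set_kind es i (snd p)) j =
            (if i < j then - 1 else 1) * (koszul_sign n es j :: 'k)"
          using koszul_sign_set_kind[where ?'k = 'k, of i es j "fst p" "snd p"] ij that by simp
        have eq3: "koszul_sign n (set_kind es j (snd q)) i =
            (if j < i then - 1 else 1) * (koszul_sign n es i :: 'k)"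
          using koszul_sign_set_kind[where ?'k = 'k, of j es i "fst q" "snd q"] ij that by simp
        have "koszul_sign n es i * fst p * ((if i < j then - 1 else 1) * koszul_sign n es j * fst q) =
            - (koszul_sign n es j * fst q * ((if j < i then - 1 else 1) * koszul_sign n es i * fst p))"
          using 2 by (cases "i < j") auto
        then show ?thesis by (simp only: B_def eq1 eq2 eq3 chain.scale_minus_left)
      qed
      then have "A i j = (\<Sum>p\<leftarrow>?bk es i. \<Sum>q\<leftarrow>?bk es j. - B j i q p)"
        unfolding A_def other by (intro arg_cong[where f = sum_list] map_cong) auto
      also have "\<dots> = - A j i"
        unfolding A_def other sum_list_uminus by (subst sum_list_swap) (rule refl)
      finally show ?thesis .
    qed
  qed
  finally show ?thesis .
qed

text \<open>
  The two vertices resulting from a splitting have total valence two more than the old vertex, which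
  is less than six for a vertex of valence three.
\<close>

lemma diff_V_trivalent:
  assumes "\<forall>(k, a, b)\<in>set es. a < n \<and> b < n" and "\<And>x. x < n \<Longrightarrow> valence es x \<le> 3"
  shows "diff_V (n, es) = (0 :: 'k::field_char_0 chain)"
proof -
  have "split_term n x fs = (0 :: 'k chain)" if "x < n" "fs \<in> set (reattachments x n es)" for x fs
  proof -
    have "valence fs x + valence fs n \<le> 3"
      using reattachments_valence(2)[OF that(2) assms(1) that(1)] assms(2)[OF that(1)] by simp
    then show ?thesis using that(1) by (auto simp: split_term_def valence_append valence_def)
  qed
  then have "(\<Sum>fs\<leftarrow>reattachments x n es. split_term n x fs) =
      (\<Sum>fs\<leftarrow>reattachments x n es. (0 :: 'k chain))"
    if "x < n" for x
    using that by (intro arg_cong[where f = sum_list] map_cong) auto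
  then show ?thesis by (simp add: diff_V_split_term)
qed


section \<open>The sign of a list\<close>

text \<open>
  This is the sign of the permutation that sorts the list, and zero if an entry is repeated. The
  product over pairs makes it visible that an adjacent transposition changes the sign of a single factor.
\<close>

fun list_sign :: "nat list \<Rightarrow> int" where
  "list_sign [] = 1"
| "list_sign (x # xs) = (\<Prod>y\<leftarrow>xs. sgn (int y - int x)) * list_sign xs"

lemma list_sign_swap: "list_sign (xs @ a # b # ys) = - list_sign (xs @ b # a # ys)"
proof (induction xs)
  case Nil
  have "sgn (int b - int a) = - sgn (int a - int b)" by (simp add: sgn_if)
  then show ?case by simp
qed simp

lemma list_sign_swap_distant: "list_sign (xs @ a # zs @ b # ys) = - list_sign (xs @ b # zs @ a # ys)"
proof (induction zs arbitrary: xs)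
  case (Cons z zs)
  have "list_sign (xs @ a # (z # zs) @ b # ys) = - list_sign ((xs @ [z]) @ a # zs @ b # ys)"
    using list_sign_swap[of xs a z] by simp
  also have "\<dots> = list_sign (xs @ z # b # zs @ a # ys)" using Cons[of "xs @ [z]"] by simp
  also have "\<dots> = - list_sign (xs @ b # (z # zs) @ a # ys)" using list_sign_swap[of xs z b] by simp
  finally show ?case .
qed (simp add: list_sign_swap[of _ a b])

lemma list_sign_nonzero_iff: "list_sign xs \<noteq> 0 \<longleftrightarrow> distinct xs"
  by (induction xs) (auto simp: prod_list_zero_iff sgn_if split: if_splits)

lemma list_sign_square: "distinct xs \<Longrightarrow> list_sign xs * list_sign xs = 1"
proof (induction xs)
  case (Cons x xs)
  have squares: "prod_list (map f xs) * prod_list (map f xs) = 1" if "\<And>y. y \<in> set xs \<Longrightarrow> f y * f y = 1"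
    for f :: "nat \<Rightarrow> int"
    using that by (induction xs) (auto simp: algebra_simps)
  have "sgn (int y - int x) * sgn (int y - int x) = 1" if "y \<in> set xs" for y
    using Cons.prems that by (auto simp: sgn_if)
  then have "(\<Prod>y\<leftarrow>xs. sgn (int y - int x)) * (\<Prod>y\<leftarrow>xs. sgn (int y - int x)) = 1"
    by (rule squares)
  then show ?case using Cons by (simp add: algebra_simps)
qed simp

text \<open>
  Adjacent transpositions generate all rearrangements, so that statements about graphs can be transferred
  to a convenient order of the edges.
\<close>

lemma adjacent_swaps_mset:
  assumes "mset xs = mset ys" and swap: "\<And>us a b vs. P (us @ a # b # vs) = P (us @ b # a # vs)"
  shows "P xs = P ys"
proof -
  have front: "P (us @ vs @ x # ws) = P (us @ x # vs @ ws)" for us vs x ws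
  proof (induction vs arbitrary: us)
    case (Cons v vs)
    then show ?case using Cons[of "us @ [v]"] swap[of us v x] by simp
  qed simp
  have "P (us @ xs) = P (us @ ys)" for us
    using assms(1)
  proof (induction xs arbitrary: us ys)
    case (Cons x xs)
    then have "x \<in> set ys" by (metis list.set_intros(1) set_mset_mset)
    then obtain vs ws where ys: "ys = vs @ x # ws" by (meson split_list)
    with Cons.prems have "mset xs = mset (vs @ ws)" by simp
    then show ?case using Cons.IH[of "vs @ ws" "us @ [x]"] front[of us vs x ws] by (simp add: ys)
  qed simp
  from this[of "[]"] show ?thesis by simp
qed

lemma list_sign_map_reorder:
  assumes "mset xs = mset ys"
  shows "list_sign (map f xs) * list_sign (map g xs) = list_sign (map f ys) * list_sign (map g ys)"
proof (rule adjacent_swaps_mset[OF assms])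
  fix us a b vs
  show "list_sign (map f (us @ a # b # vs)) * list_sign (map g (us @ a # b # vs)) =
      list_sign (map f (us @ b # a # vs)) * list_sign (map g (us @ b # a # vs))"
    using list_sign_swap[of "map f us" "f a" "f b" "map f vs"] list_sign_swap[of "map g us" "g a" "g b" "map g vs"]
    by simp
qed

text \<open>
  The product of two functions that change sign under adjacent transpositions is symmetric, so it
  takes the same value on all orderings of the list \<open>ref\<close>.
\<close>

lemma list_sign_map_permutation:
  assumes "distinct ref" "set xs = set ref" "length xs = length ref" "inj_on g (set ref)"
  shows "list_sign (map f xs) = list_sign (map f ref) * list_sign (map g ref) * list_sign (map g xs)"
proof -
  have "distinct xs" using assms by (metis card_distinct distinct_card)
  then have "mset xs = mset ref" using assms(1,2) set_eq_iff_mset_eq_distinct by blast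
  moreover have "distinct (map g xs)" using \<open>distinct xs\<close> assms by (simp add: distinct_map)
  ultimately show ?thesis
    using list_sign_map_reorder[of xs ref f g] list_sign_square[of "map g xs"] by (metis mult.assoc mult.right_neutral)
qed


section \<open>The weight of a tetrahedron\<close>

fun ends :: "edge \<Rightarrow> nat set" where
  "ends (k, a, b) = {a, b}"

text \<open>
  The binary encoding of finite sets, which numbers the six edges of the tetrahedron injectively. A
  different numbering would change the weight by a global sign.
\<close>

definition vertex_code :: "nat set \<Rightarrow> nat" where
  "vertex_code A = (\<Sum>i\<in>A. 2 ^ i)"

definition edge_code :: "edge \<Rightarrow> nat" where
  "edge_code e = vertex_code (ends e)"

definition of_kind :: "edge_kind \<Rightarrow> edge list \<Rightarrow> edge list" where
  "of_kind k es = filter (\<lambda>e. fst e = k) es"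

text \<open>
  No solid edge has its tail at a solid target or its head at a solid source. So the vertices that make a
  graph with edges of kind \<open>k\<close> belong to the subcomplex are never marked ends of solid edges.
\<close>

fun marked_end :: "edge_kind \<Rightarrow> edge \<Rightarrow> nat" where
  "marked_end k (l, a, b) = (if k = SDotted then a else b)"

text \<open>
  For a list of three numbers below four, this is the determinant with rows the corresponding unit
  vectors and, as last row, the vector \<open>(1, 1, 1, 1)\<close>. It is nonzero exactly if the three
  numbers are distinct.
\<close>

definition rooted_sign :: "nat list \<Rightarrow> int" where
  "rooted_sign us = (\<Sum>r<4. list_sign (us @ [r]))"

definition on_four :: "edge list \<Rightarrow> bool" where
  "on_four es \<longleftrightarrow> (\<forall>(k, a, b)\<in>set es. a < 4 \<and> b < 4 \<and> a \<noteq> b)"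

text \<open>
  The solid edges are listed before the dotted ones. Interchanging two solid edges changes the sign of
  both factors, so that the product treats solid edges as even and dotted edges as odd, as the
  orientation of a graph demands.
\<close>

fun weight :: "edge_kind \<Rightarrow> graph \<Rightarrow> int" where
  "weight k (n, es) =
     (if n = 4 \<and> length es = 6 \<and> length (of_kind Solid es) = 3 \<and> length (of_kind k es) = 3 \<and> on_four es
      then rooted_sign (map (marked_end k) (of_kind Solid es)) *
           list_sign (map edge_code (of_kind Solid es @ of_kind k es))
      else 0)"

lemma of_kind_append [simp]: "of_kind k (xs @ ys) = of_kind k xs @ of_kind k ys"
  and of_kind_Cons [simp]: "of_kind k (e # ys) = (if fst e = k then e # of_kind k ys else of_kind k ys)"
  and of_kind_Nil [simp]: "of_kind k [] = []"
  by (simp_all add: of_kind_def)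

lemma on_four_append [simp]: "on_four (xs @ ys) \<longleftrightarrow> on_four xs \<and> on_four ys"
  and on_four_Cons [simp]: "on_four ((k, a, b) # ys) \<longleftrightarrow> a < 4 \<and> b < 4 \<and> a \<noteq> b \<and> on_four ys"
  and on_four_Nil [simp]: "on_four []"
  unfolding on_four_def by (simp_all add: ball_Un)

lemma length_of_kinds:
  assumes "k \<noteq> Solid"
  shows "length (of_kind Solid es) + length (of_kind k es) \<le> length es"
    and "e \<in> set es \<Longrightarrow> fst e \<noteq> Solid \<Longrightarrow> fst e \<noteq> k \<Longrightarrow>
           length (of_kind Solid es) + length (of_kind k es) < length es"
proof -
  show *: "length (of_kind Solid es) + length (of_kind k es) \<le> length es" for es
    using assms by (induction es) auto
  show "length (of_kind Solid es) + length (of_kind k es) < length es"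
    if e: "e \<in> set es" "fst e \<noteq> Solid" "fst e \<noteq> k"
  proof -
    from e(1) obtain xs ys where es: "es = xs @ e # ys" by (meson split_list)
    show ?thesis using *[of xs] *[of ys] e by (simp add: es)
  qed
qed

lemma weight_other_kind:
  assumes "e \<in> set es" "fst e \<noteq> Solid" "fst e \<noteq> k" "k \<noteq> Solid"
  shows "weight k (n, es) = 0"
  using length_of_kinds(2)[OF assms(4,1,2,3)] by auto

lemma rooted_sign_swap: "rooted_sign (xs @ a # b # ys) = - rooted_sign (xs @ b # a # ys)"
  unfolding rooted_sign_def sum_negf[symmetric]
  using list_sign_swap[of xs a b] by (intro sum.cong refl) simp

lemma weight_swap:
  assumes "k = SDotted \<or> k = TDotted"
  shows "weight k (n, xs @ e # f # ys) =
    (if dotted e \<and> dotted f then -1 else 1) * weight k (n, xs @ f # e # ys)"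
proof -
  consider "fst e = Solid" "fst f = Solid" | "fst e = k" "fst f = k"
    | "fst e = Solid" "fst f = k" | "fst e = k" "fst f = Solid"
    | "fst e \<noteq> Solid \<and> fst e \<noteq> k \<or> fst f \<noteq> Solid \<and> fst f \<noteq> k" by blast
  then show ?thesis
  proof cases
    case 1
    then show ?thesis
      using assms rooted_sign_swap[of "map (marked_end k) (of_kind Solid xs)" "marked_end k e" "marked_end k f"
          "map (marked_end k) (of_kind Solid ys)"]
        list_sign_swap[of "map edge_code (of_kind Solid xs)" "edge_code e" "edge_code f"
          "map edge_code (of_kind Solid ys @ of_kind k xs @ of_kind k ys)"]
      by (cases e; cases f) auto
  next
    case 2
    then show ?thesis
      using assms
        list_sign_swap[of "map edge_code (of_kind Solid xs @ of_kind Solid ys @ of_kind k xs)" "edge_code e" "edge_code f"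
          "map edge_code (of_kind k ys)"]
      by (cases e; cases f) auto
  next
    case 5
    have "weight k (n, xs @ e # f # ys) = 0" "weight k (n, xs @ f # e # ys) = 0"
      using 5 assms weight_other_kind[of e _ k n] weight_other_kind[of f _ k n]
      by (auto simp del: weight.simps)
    then show ?thesis by simp
  qed (use assms in \<open>(cases e; cases f; auto)+\<close>)
qed

lemma weight_reverse:
  assumes "l \<noteq> Solid"
  shows "weight k (n, xs @ (l, a, b) # ys) = weight k (n, xs @ (l, b, a) # ys)"
  using assms by (simp add: edge_code_def insert_commute[of a b] conj_ac eq_commute[of a b])

definition tetrahedron_edges :: "nat set list" where
  "tetrahedron_edges = [{0, 1}, {0, 2}, {1, 2}, {0, 3}, {1, 3}, {2, 3}]"

lemma vertex_code_tetrahedron: "map vertex_code tetrahedron_edges = [3, 5, 6, 9, 10, 12]"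
  by (simp add: tetrahedron_edges_def vertex_code_def)

lemma distinct_tetrahedron_edges: "distinct tetrahedron_edges" "inj_on vertex_code (set tetrahedron_edges)"
proof -
  have "distinct (map vertex_code tetrahedron_edges)" unfolding vertex_code_tetrahedron by simp
  then show "distinct tetrahedron_edges" "inj_on vertex_code (set tetrahedron_edges)"
    by (auto simp: distinct_map)
qed

lemma less_4: "(a :: nat) < 4 \<longleftrightarrow> a = 0 \<or> a = 1 \<or> a = 2 \<or> a = 3"
  by presburger

lemma ends_tetrahedron:
  assumes "a < 4" "b < 4" "a \<noteq> b" shows "ends (k, a, b) \<in> set tetrahedron_edges"
  using assms unfolding less_4 tetrahedron_edges_def
  by (elim disjE) (simp_all add: doubleton_eq_iff)

lemma set_ends_tetrahedron:
  assumes "on_four es" "distinct (map edge_code es)" "length es = 6"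
  shows "set (map ends es) = set tetrahedron_edges"
proof (rule card_subset_eq)
  show "set (map ends es) \<subseteq> set tetrahedron_edges"
    using assms(1) ends_tetrahedron by (fastforce simp: on_four_def)
  have "distinct (map ends es)"
    using assms(2) by (simp add: edge_code_def[abs_def] distinct_map inj_on_def)
  then have "card (set (map ends es)) = 6" using assms(3) by (metis distinct_card length_map)
  moreover have "card (set tetrahedron_edges) = 6"
    using distinct_card[OF distinct_tetrahedron_edges(1)] by (simp add: tetrahedron_edges_def)
  ultimately show "card (set (map ends es)) = card (set tetrahedron_edges)" by simp
qed simp

text \<open>
  A transposition of two vertices of the tetrahedron fixes two of the six edges and interchanges
  the others in two pairs: it is odd on the vertices, but even on the edges.
\<close>

lemma list_sign_transposed_tetrahedron:
  assumes "i < 4" "j < 4" "i \<noteq> j"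
  shows "list_sign (map (\<lambda>A. vertex_code (transpose i j ` A)) tetrahedron_edges) = 1"
    and "list_sign (map (transpose i j) [0, 1, 2, 3]) = -1"
  using assms unfolding less_4 tetrahedron_edges_def vertex_code_def
  by (elim disjE; simp add: transpose_def)+

lemma rooted_sign_transpose:
  assumes "i < 4" "j < 4" "i \<noteq> j" and "length us = 3" "set us \<subseteq> {..<4}"
  shows "rooted_sign (map (transpose i j) us) = - rooted_sign us"
proof -
  let ?t = "transpose i j"
  have t: "?t permutes {..<4}" using assms by (intro permutes_swap_id) auto
  have each: "list_sign (map ?t ws) = - list_sign ws" if ws: "length ws = 4" "set ws \<subseteq> {..<4}" for ws
  proof (cases "distinct ws")
    case True
    have "set ws = set [0, 1, 2, 3]"
      using True ws distinct_card[of ws] by (intro card_subset_eq) (auto simp: less_4)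
    then show ?thesis
      using list_sign_map_permutation[of "[0, 1, 2, 3]" ws id ?t] ws list_sign_transposed_tetrahedron(2)[OF assms(1-3)]
      by simp
  next
    case False
    then have "\<not> distinct (map ?t ws)" by (simp add: distinct_map)
    with False show ?thesis using list_sign_nonzero_iff by (metis minus_zero)
  qed
  have "rooted_sign (map ?t us) = (\<Sum>r<4. list_sign (map ?t us @ [?t r]))"
    unfolding rooted_sign_def using sum.permute[OF t, of "\<lambda>r. list_sign (map ?t us @ [r])"] by (simp add: comp_def)
  also have "\<dots> = (\<Sum>r<4. - list_sign (us @ [r]))"
    using each[of "us @ [_]"] assms by (intro sum.cong) auto
  finally show ?thesis by (simp add: rooted_sign_def sum_negf)
qed

lemma ends_relabel: "map ends (relabel \<sigma> es) = map (image \<sigma>) (map ends es)"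
  by (induction es) (auto simp: relabel_def)

lemma of_kind_relabel: "of_kind k (relabel \<sigma> es) = relabel \<sigma> (of_kind k es)"
  by (induction es) (auto simp: relabel_def)

lemma marked_end_relabel: "map (marked_end k) (relabel \<sigma> es) = map \<sigma> (map (marked_end k) es)"
  by (induction es) (auto simp: relabel_def)

lemma length_relabel [simp]: "length (relabel \<sigma> es) = length es"
  by (simp add: relabel_def)

lemma map_edge_code: "map edge_code es = map vertex_code (map ends es)"
  by (simp add: edge_code_def)

lemma list_sign_edge_code_transpose:
  assumes "i < 4" "j < 4" "i \<noteq> j" and "on_four es" "length es = 6"
  shows "list_sign (map edge_code (relabel (transpose i j) es)) = list_sign (map edge_code es)"
proof (cases "distinct (map edge_code es)")
  case True
  have "list_sign (map (\<lambda>A. vertex_code (transpose i j ` A)) (map ends es)) = list_sign (map vertex_code (map ends es))"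
    using set_ends_tetrahedron[OF assms(4) True assms(5)] distinct_tetrahedron_edges assms(5)
    by (subst list_sign_map_permutation[of tetrahedron_edges _ vertex_code])
      (simp_all add: list_sign_transposed_tetrahedron(1)[OF assms(1-3)] vertex_code_tetrahedron,
       simp add: tetrahedron_edges_def)
  then show ?thesis by (simp add: map_edge_code ends_relabel comp_def)
next
  case False
  have "inj_on vertex_code (ends ` set es)"
    using assms(4) ends_tetrahedron
    by (intro inj_on_subset[OF distinct_tetrahedron_edges(2)]) (fastforce simp: on_four_def)
  then have "\<not> distinct (map ends es)" using False by (simp add: map_edge_code distinct_map del: map_map)
  then have "\<not> distinct (map edge_code (relabel (transpose i j) es))"
    unfolding map_edge_code ends_relabel by (metis distinct_map)
  with False show ?thesis using list_sign_nonzero_iff by metis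
qed

lemma relabel_comp: "relabel (f \<circ> g) es = relabel f (relabel g es)"
  by (simp add: relabel_def case_prod_beta comp_def)

lemma on_four_relabel:
  assumes "p permutes {..<4}" shows "on_four (relabel p es) \<longleftrightarrow> on_four es"
proof -
  have "p a < 4 \<longleftrightarrow> a < 4" "p a = p b \<longleftrightarrow> a = b" for a b
    using permutes_in_image[OF assms, of a] permutes_inj[OF assms] by (auto simp: inj_eq)
  then show ?thesis by (induction es) (auto simp: relabel_def on_four_def)
qed

lemma weight_transpose:
  assumes "i < 4" "j < 4" "i \<noteq> j"
  shows "weight k (4, relabel (transpose i j) es) = - weight k (4, es)"
proof -
  have t: "transpose i j permutes {..<4}" using assms by (intro permutes_swap_id) auto
  show ?thesis
  proof (cases "length es = 6 \<and> length (of_kind Solid es) = 3 \<and> length (of_kind k es) = 3 \<and> on_four es")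
    case True
    have on: "on_four (of_kind Solid es @ of_kind k es)"
      using True by (auto simp: on_four_def of_kind_def)
    have "set (map (marked_end k) (of_kind Solid es)) \<subseteq> {..<4}"
      using True by (auto simp: on_four_def of_kind_def)
    then show ?thesis
      using True rooted_sign_transpose[OF assms, of "map (marked_end k) (of_kind Solid es)"]
        list_sign_edge_code_transpose[OF assms on]
      by (simp add: of_kind_relabel on_four_relabel[OF t] marked_end_relabel del: map_map map_append)
  qed (auto simp: of_kind_relabel on_four_relabel[OF t])
qed

lemma weight_relabel:
  assumes "\<sigma> permutes {..<n}"
  shows "weight k (n, es) = sign \<sigma> * weight k (n, relabel \<sigma> es)"
proof (cases "n = 4")
  case True
  from assms have "\<sigma> permutes {..<4 :: nat}" using True by simp
  then have "weight k (4, relabel \<sigma> es) = sign \<sigma> * weight k (4, es)"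
    using finite_lessThan
  proof (induction rule: permutes_induct)
    case (swap a b p)
    have sg: "sign (transpose a b \<circ> p) = - sign p"
      using swap.hyps sign_compose[OF permutation_swap_id, of p a b] permutation_permutes
      by (auto simp: sign_swap_id)
    show ?case
      unfolding relabel_comp sg
      using swap weight_transpose[of a b k "relabel p es"] by (simp del: weight.simps)
  qed (simp add: relabel_def)
  then show ?thesis using True by (simp del: weight.simps flip: mult.assoc)
qed simp

lemma weight_Z_graph:
  assumes "Z_graph (n, es)" and "k = SDotted \<or> k = TDotted"
  shows "weight k (n, es) = 0"
proof -
  have "\<exists>e\<in>set es. fst e \<noteq> Solid \<and> fst e \<noteq> k"
  proof (cases "has_kind Wavy es")
    case False
    then have "num_kind Wavy es = 0" by (simp add: has_kind_iff num_kind_count count_list_0_iff)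
    then show ?thesis using False assms by (force simp: has_kind_def)
  qed (use assms in \<open>force simp: has_kind_def\<close>)
  then show ?thesis using weight_other_kind assms(2) by blast
qed

text \<open>
  By the preceding lemmas the weight is compatible with all changes of orientation, and it needs three
  solid and three dotted edges of one kind, which excludes the graphs generating \<open>Z3\<close>.
\<close>

lemma pairing_weight_Z3:
  assumes "x \<in> Z3" and k: "k = SDotted \<or> k = TDotted"
  shows "pairing (weight k) x = 0"
  using assms(1) unfolding Z3_def
proof (induction rule: chain.span_induct)
  case base
  show ?case by (auto simp: chain.subspace_def pairing.add pairing.scale pairing.zero)
next
  case (step x)
  then show ?case
  proof
    assume "x \<in> relators"
    then show ?thesis
    proof (cases rule: relatorE)
      case (relabel n es \<sigma>)
      have "of_int (weight k (n, es)) = (of_int (sign \<sigma>) * of_int (weight k (n, relabel \<sigma> es)) :: 'a)"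
        using arg_cong[OF weight_relabel[OF relabel(2), of k es], of of_int] by simp
      then show ?thesis by (simp add: relabel(3) pairing.diff pairing.scale del: weight.simps)
    next
      case (swap n xs e f ys)
      then show ?thesis
        using weight_swap[OF k, of n xs e f ys]
        by (simp add: pairing.diff pairing.scale swap_sign_def del: weight.simps)
    next
      case (reverse n xs l a b ys)
      then show ?thesis
        using weight_reverse[OF reverse(2), of k n xs a b ys]
        by (simp add: pairing.diff del: weight.simps)
    qed
  next
    assume "x \<in> gr ` {G. admissible G \<and> Z_graph G}"
    then show ?thesis using weight_Z_graph[OF _ k] by (auto simp del: weight.simps)
  qed
qed


declare weight.simps [simp del]

section \<open>The weight vanishes on vertex splittings\<close>

definition split_weight :: "edge_kind \<Rightarrow> nat \<Rightarrow> edge list \<Rightarrow> int" where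
  "split_weight k x fs =
     (if valence (fs @ [(Solid, x, 3)]) x \<ge> 3 \<and> valence (fs @ [(Solid, x, 3)]) 3 \<ge> 3
      then weight k (4, fs @ [(Solid, x, 3)]) else 0)"

definition total_split_weight :: "edge_kind \<Rightarrow> nat \<Rightarrow> edge list \<Rightarrow> int" where
  "total_split_weight k x es = (\<Sum>fs\<leftarrow>reattachments x 3 es. split_weight k x fs)"

lemma split_weight_swap:
  assumes "k = SDotted \<or> k = TDotted"
  shows "split_weight k x (us @ e # f # vs) =
    (if dotted e \<and> dotted f then -1 else 1) * split_weight k x (us @ f # e # vs)"
  using weight_swap[OF assms, of 4 us e f "vs @ [(Solid, x, 3)]"]
  by (simp add: split_weight_def valence_swap[of us e])

lemma total_split_weight_swap:
  assumes k: "k = SDotted \<or> k = TDotted"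
  shows "total_split_weight k x (xs @ e # f # ys) =
    (if dotted e \<and> dotted f then -1 else 1) * total_split_weight k x (xs @ f # e # ys)"
proof -
  let ?R = "reattachments x 3" and ?E = "edge_reattachments x 3"
  let ?c = "if dotted e \<and> dotted f then -1 else 1 :: int"
  have "total_split_weight k x (xs @ e # f # ys) =
      (\<Sum>us\<leftarrow>?R xs. \<Sum>e'\<leftarrow>?E e. \<Sum>f'\<leftarrow>?E f. \<Sum>vs\<leftarrow>?R ys. split_weight k x (us @ e' # f' # vs))"
    unfolding total_split_weight_def sum_list_reattachments_append sum_list_reattachments_Cons ..
  also have "\<dots> =
      (\<Sum>us\<leftarrow>?R xs. \<Sum>e'\<leftarrow>?E e. \<Sum>f'\<leftarrow>?E f. \<Sum>vs\<leftarrow>?R ys. ?c * split_weight k x (us @ f' # e' # vs))"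
  proof (intro arg_cong[where f = sum_list] map_cong refl)
    fix us e' f' vs assume "e' \<in> set (?E e)" "f' \<in> set (?E f)"
    then have "dotted e' = dotted e" "dotted f' = dotted f" by (simp_all add: dotted_iff reattached_kind)
    then show "split_weight k x (us @ e' # f' # vs) = ?c * split_weight k x (us @ f' # e' # vs)"
      using split_weight_swap[OF k, of x us e' f' vs] by simp
  qed
  also have "\<dots> = ?c * (\<Sum>us\<leftarrow>?R xs. \<Sum>f'\<leftarrow>?E f. \<Sum>e'\<leftarrow>?E e. \<Sum>vs\<leftarrow>?R ys. split_weight k x (us @ f' # e' # vs))"
    by (subst sum_list_swap[where xs = "?E e"]) (simp add: sum_list_const_mult del: edge_reattachments.simps)
  also have "\<dots> = ?c * total_split_weight k x (xs @ f # e # ys)"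
    unfolding total_split_weight_def sum_list_reattachments_append sum_list_reattachments_Cons ..
  finally show ?thesis .
qed

text \<open>
  An edge between \<open>p\<close> and \<open>u\<close>, in a direction given by a flag, with the end \<open>u\<close> singled out
  as the one that a splitting moves.
\<close>

definition edge_to :: "bool \<Rightarrow> edge_kind \<Rightarrow> nat \<Rightarrow> nat \<Rightarrow> edge" where
  "edge_to b l p u = (if b then (l, p, u) else (l, u, p))"

lemma edge_to_simps [simp]:
  "fst (edge_to b l p u) = l"
  "ends (edge_to b l p u) = {p, u}"
  "edge_code (edge_to b l p u) = vertex_code {p, u}"
  "on_four (edge_to b l p u # es) \<longleftrightarrow> p < 4 \<and> u < 4 \<and> p \<noteq> u \<and> on_four es"
  "valence (edge_to b l p u # es) z = of_bool (p = z) + of_bool (u = z) + valence es z"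
  by (auto simp: edge_to_def edge_code_def valence_Cons insert_commute[of u p])

lemma marked_end_edge_to:
  assumes "k = SDotted \<or> k = TDotted" "b = (k = SDotted)"
  shows "marked_end k (edge_to b l p u) = p"
  using assms by (auto simp: edge_to_def)

text \<open>
  Neither edge has its marked end at the free end \<open>u\<close> or \<open>v\<close> if it is solid. Exchanging the free ends
  thus only interchanges two entries in the list of edge codes. If both edges are solid they share the
  marked end \<open>p\<close>, and both weights are zero.
\<close>

lemma weight_exchange:
  assumes k: "k = SDotted \<or> k = TDotted"
    and "l = Solid \<Longrightarrow> b = (k = SDotted)" and "l' = Solid \<Longrightarrow> b' = (k = SDotted)"
  shows "weight k (n, edge_to b l p u # edge_to b' l' p v # R) =
    - weight k (n, edge_to b l p v # edge_to b' l' p u # R)"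
proof -
  let ?c = "\<lambda>u. vertex_code {p, u}" and ?S = "map edge_code (of_kind Solid R)" and ?K = "map edge_code (of_kind k R)"
  have k_Solid: "k \<noteq> Solid" using k by auto
  consider "l = Solid" "l' = Solid" | "l = Solid" "l' = k" | "l = k" "l' = Solid" | "l = k" "l' = k"
    | "l \<noteq> Solid \<and> l \<noteq> k \<or> l' \<noteq> Solid \<and> l' \<noteq> k" by blast
  then show ?thesis
  proof cases
    case 1
    have "rooted_sign (p # p # us) = 0" for us using rooted_sign_swap[of "[]" p p us] by simp
    with 1 show ?thesis using assms by (simp add: weight.simps marked_end_edge_to)
  next
    case 2
    then show ?thesis
      using assms list_sign_swap_distant[of "[]" "?c u" ?S "?c v" ?K]
      by (auto simp: weight.simps marked_end_edge_to)
  next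
    case 3
    then show ?thesis
      using assms list_sign_swap_distant[of "[]" "?c v" ?S "?c u" ?K]
      by (auto simp: weight.simps marked_end_edge_to)
  next
    case 4
    then show ?thesis
      using k_Solid list_sign_swap[of ?S "?c u" "?c v" ?K] by (auto simp: weight.simps)
  next
    case 5
    have "weight k (n, edge_to b l p u # edge_to b' l' p v # R) = 0" for u v
      using 5 k_Solid weight_other_kind[of "edge_to b l p u" _ k n] weight_other_kind[of "edge_to b' l' p v" _ k n]
      by auto
    then show ?thesis by simp
  qed
qed

text \<open>
  When \<open>x\<close> is split, the two edges are distributed over the two new vertices independently, and the
  terms cancel in pairs.
\<close>

lemma total_split_weight_parallel:
  assumes k: "k = SDotted \<or> k = TDotted" and "p \<noteq> x" "p \<noteq> 3"
    and "l = Solid \<Longrightarrow> b = (k = SDotted)" and "l' = Solid \<Longrightarrow> b' = (k = SDotted)"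
  shows "total_split_weight k x (edge_to b l p x # edge_to b' l' p x # R) = 0"
proof -
  have E: "edge_reattachments x 3 (edge_to b l p x) = [edge_to b l p x, edge_to b l p 3]" for b l
    using assms(2) by (auto simp: edge_to_def)
  have exch: "split_weight k x (edge_to b l p u # edge_to b' l' p v # fs) =
      - split_weight k x (edge_to b l p v # edge_to b' l' p u # fs)" for u v fs
  proof -
    have "valence (edge_to b l p u # edge_to b' l' p v # fs) z =
        valence (edge_to b l p v # edge_to b' l' p u # fs) z" for z by simp
    then show ?thesis
      using weight_exchange[OF k assms(4,5), where n = 4 and u = u and v = v and R = "fs @ [(Solid, x, 3)]"]
      by (simp add: split_weight_def valence_append flip: append_Cons del: edge_to_simps)
  qed
  have "split_weight k x (edge_to b l p u # edge_to b' l' p u # fs) = 0" for u fs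
    using exch[of u u fs] by simp
  moreover note exch[of 3 x]
  ultimately show ?thesis
    by (simp add: total_split_weight_def sum_list_reattachments_Cons E sum_list_uminus)
qed

text \<open>
  The free end of an edge that was moved to \<open>x\<close> or \<open>3\<close> was at \<open>x\<close> before the splitting.
\<close>

lemma reattached_edge_to:
  assumes k: "k = SDotted \<or> k = TDotted"
    and f: "f \<in> set (edge_reattachments x 3 e)" and e: "case e of (l, a, b) \<Rightarrow> a < 3 \<and> b < 3"
    and "ends f = {p, u}" "u = x \<or> u = 3" "p \<noteq> x" "p < 3" "x < 3"
    and free: "\<not> (fst f = Solid \<and> marked_end k f \<in> {x, 3})"
  obtains b where "e = edge_to b (fst f) p x" "fst f = Solid \<longrightarrow> b = (k = SDotted)"
proof -
  obtain l a b where e_eq: "e = (l, a, b)" by (cases e) auto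
  obtain l' a' b' where f_eq: "f = (l', a', b')" by (cases f) auto
  note f' = edge_reattachmentsD[OF f[unfolded e_eq f_eq]]
  have "a' = p \<and> b' = u \<or> a' = u \<and> b' = p" using assms(4) by (auto simp: f_eq doubleton_eq_iff)
  then have "a' = p \<and> a = p \<and> b' = u \<and> b = x \<or> b' = p \<and> b = p \<and> a' = u \<and> a = x"
    using f' e assms(5-8) by (auto simp: e_eq)
  then show ?thesis
  proof
    assume *: "a' = p \<and> a = p \<and> b' = u \<and> b = x"
    show ?thesis
      by (rule that[of True]) (use * f' k free assms(5) in \<open>auto simp: e_eq f_eq edge_to_def\<close>)
  next
    assume *: "b' = p \<and> b = p \<and> a' = u \<and> a = x"
    show ?thesis
      by (rule that[of False]) (use * f' k free assms(5) in \<open>auto simp: e_eq f_eq edge_to_def\<close>)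
  qed
qed

lemma mset_two_nth:
  assumes "i < length xs" "j < length xs" "i \<noteq> j"
  obtains R where "mset xs = mset (xs ! i # xs ! j # R)"
proof -
  have xs: "xs = take i xs @ xs ! i # drop (Suc i) xs" using assms(1) by (rule id_take_nth_drop)
  have "xs ! j \<in> set (take i xs @ drop (Suc i) xs)"
  proof (cases "j < i")
    case True
    then have "take i xs ! j \<in> set (take i xs)" using assms by (intro nth_mem) auto
    with True show ?thesis by simp
  next
    case False
    then have "drop (Suc i) xs ! (j - Suc i) \<in> set (drop (Suc i) xs)" using assms by (intro nth_mem) auto
    with False assms show ?thesis by simp
  qed
  then obtain A B where "take i xs @ drop (Suc i) xs = A @ xs ! j # B" by (meson split_list)
  then have "mset (take i xs) + mset (drop (Suc i) xs) = mset (xs ! j # A @ B)"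
    by (metis mset_append mset.simps(2) union_mset_add_mset_right)
  then have "mset xs = mset (xs ! i # xs ! j # A @ B)" by (subst xs) simp
  then show ?thesis by (rule that)
qed

lemma weight_nonzeroD:
  assumes "weight k (n, es) \<noteq> 0"
  shows "n = 4" "length es = 6" "length (of_kind Solid es) = 3" "length (of_kind k es) = 3"
    "on_four es" "set tetrahedron_edges \<subseteq> ends ` set es" "inj_on (marked_end k) (set (of_kind Solid es))"
proof -
  show *: "n = 4" "length es = 6" "length (of_kind Solid es) = 3" "length (of_kind k es) = 3" "on_four es"
    using assms by (auto simp: weight.simps split: if_splits)
  let ?L = "of_kind Solid es @ of_kind k es"
  have "list_sign (map edge_code ?L) \<noteq> 0" and r: "rooted_sign (map (marked_end k) (of_kind Solid es)) \<noteq> 0"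
    using assms by (auto simp: weight.simps split: if_splits)
  then have "distinct (map edge_code ?L)" using list_sign_nonzero_iff by blast
  moreover have "on_four ?L" "set ?L \<subseteq> set es" using *(5) by (auto simp: on_four_def of_kind_def)
  moreover have "length ?L = 6" using *(3,4) by simp
  ultimately have "set (map ends ?L) = set tetrahedron_edges" and sub: "set ?L \<subseteq> set es"
    using set_ends_tetrahedron by blast+
  with image_mono[OF sub, of ends] show "set tetrahedron_edges \<subseteq> ends ` set es"
    by (simp only: list.set_map)
  from r obtain z where "list_sign (map (marked_end k) (of_kind Solid es) @ [z]) \<noteq> 0"
    unfolding rooted_sign_def by (rule sum.not_neutral_contains_not_neutral)
  then have "distinct (map (marked_end k) (of_kind Solid es) @ [z])" using list_sign_nonzero_iff by blast
  then show "inj_on (marked_end k) (set (of_kind Solid es))" by (simp add: distinct_map)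
qed

text \<open>
  If some splitting at \<open>x\<close> is a tetrahedron of nonzero weight, then each of the two other vertices \<open>p\<close>
  sends one edge to \<open>x\<close> and one to the new vertex \<open>3\<close>. The three solid edges have distinct marked ends,
  and one of \<open>x\<close> and \<open>3\<close> is the marked end of the new edge. Hence at most one other solid edge has its
  marked end in \<open>{x, 3}\<close>, and it meets only one of the two vertices \<open>p\<close>; the other \<open>p\<close> provides the pair
  to which the cancellation applies.
\<close>

lemma parallel_pair:
  assumes k: "k = SDotted \<or> k = TDotted"
    and range: "\<forall>(l, a, b)\<in>set es. a < 3 \<and> b < 3" and x: "x < 3"
    and fs: "fs \<in> set (reattachments x 3 es)" and nz: "weight k (4, fs @ [(Solid, x, 3)]) \<noteq> 0"
  obtains p b l b' l' R where "p \<noteq> x" "p < 3" "l = Solid \<longrightarrow> b = (k = SDotted)"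
    "l' = Solid \<longrightarrow> b' = (k = SDotted)" "mset es = mset (edge_to b l p x # edge_to b' l' p x # R)"
proof -
  let ?new = "(Solid, x, 3) :: edge"
  let ?fs = "fs @ [?new]"
  let ?free = "\<lambda>f. \<not> (fst f = Solid \<and> marked_end k f \<in> {x, 3})"
  note W = weight_nonzeroD[OF nz]
  have "\<exists>p<3. p \<noteq> x \<and> (\<forall>f\<in>set ?fs. ends f = {p, x} \<or> ends f = {p, 3} \<longrightarrow> ?free f)"
  proof (rule ccontr)
    assume contra: "\<not> ?thesis"
    obtain p q where pq: "p < 3" "q < 3" "p \<noteq> x" "q \<noteq> x" "p \<noteq> q"
    proof -
      have "x = 0 \<or> x = 1 \<or> x = 2" using x by auto
      then show ?thesis by (elim disjE) (rule that[of 1 2] that[of 0 2] that[of 0 1]; simp)+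
    qed
    obtain f where f: "f \<in> set ?fs" "ends f = {p, x} \<or> ends f = {p, 3}" "\<not> ?free f" using contra pq by blast
    obtain g where g: "g \<in> set ?fs" "ends g = {q, x} \<or> ends g = {q, 3}" "\<not> ?free g" using contra pq by blast
    have pf: "p \<in> ends f" and qg: "q \<in> ends g" using f(2) g(2) by auto
    have "p \<notin> ends g" using g(2) pq by auto
    with pf have "f \<noteq> g" by auto
    have "p \<notin> ends ?new" "q \<notin> ends ?new" using pq by auto
    with pf qg have "f \<noteq> ?new" "g \<noteq> ?new" by (auto simp del: ends.simps)
    note this \<open>f \<noteq> g\<close>
    \<comment> \<open>Three solid edges with distinct marked ends cannot all have them in a two-element set.\<close>
    moreover have "{f, g, ?new} \<subseteq> set (of_kind Solid ?fs)" using f g by (auto simp: of_kind_def)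
    ultimately have "marked_end k f \<noteq> marked_end k g" "marked_end k f \<noteq> marked_end k ?new"
      "marked_end k g \<noteq> marked_end k ?new"
      using inj_on_eq_iff[OF W(7)] by (simp_all only: insert_subset) blast+
    moreover have "marked_end k ?new \<in> {x, 3}" by auto
    ultimately show False using f(3) g(3) by (metis insertE singletonD)
  qed
  then obtain p where p: "p < 3" "p \<noteq> x"
    and free: "\<And>f. f \<in> set ?fs \<Longrightarrow> ends f = {p, x} \<or> ends f = {p, 3} \<Longrightarrow> ?free f" by blast
  have all2: "list_all2 (\<lambda>f e. f \<in> set (edge_reattachments x 3 e)) fs es"
    using fs by (simp add: set_reattachments)
  have pick: "\<exists>i<length fs. ends (fs ! i) = {p, u} \<and> (\<exists>b. es ! i = edge_to b (fst (fs ! i)) p x \<and>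
      (fst (fs ! i) = Solid \<longrightarrow> b = (k = SDotted)))" if u: "u = x \<or> u = 3" for u
  proof -
    have "ends (Solid, p, u) \<in> set tetrahedron_edges" using ends_tetrahedron[of p u] u p x by auto
    then obtain f where f: "f \<in> set ?fs" "ends f = {p, u}" using W(6) by force
    have "p \<notin> ends ?new" using p by auto
    then have "f \<noteq> ?new" using f(2) by (metis insertI1)
    then have "f \<in> set fs" using f(1) by auto
    then obtain i where i: "i < length fs" "fs ! i = f" by (auto simp: in_set_conv_nth)
    then have len: "i < length es" using all2 list_all2_lengthD by fastforce
    have re: "f \<in> set (edge_reattachments x 3 (es ! i))" using list_all2_nthD[OF all2 i(1)] i(2) by simp
    have rg: "case es ! i of (l, a, b) \<Rightarrow> a < 3 \<and> b < 3" using range len by (metis nth_mem)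
    have "?free f" using free[OF f(1)] f(2) u by blast
    from reattached_edge_to[OF k re rg f(2) u p(2,1) x this]
    obtain b where "es ! i = edge_to b (fst f) p x" "fst f = Solid \<longrightarrow> b = (k = SDotted)" .
    then show ?thesis using i f(2) by blast
  qed
  obtain i b where i: "i < length fs" "ends (fs ! i) = {p, x}" "es ! i = edge_to b (fst (fs ! i)) p x"
    "fst (fs ! i) = Solid \<longrightarrow> b = (k = SDotted)" using pick[of x] by blast
  obtain j b' where j: "j < length fs" "ends (fs ! j) = {p, 3}" "es ! j = edge_to b' (fst (fs ! j)) p x"
    "fst (fs ! j) = Solid \<longrightarrow> b' = (k = SDotted)" using pick[of 3] by blast
  have "i \<noteq> j" using i(2) j(2) p x by (auto simp: doubleton_eq_iff)
  moreover have "length fs = length es" using all2 by (rule list_all2_lengthD)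
  ultimately obtain R where "mset es = mset (es ! i # es ! j # R)"
    using mset_two_nth[of i es j] i(1) j(1) by auto
  then show ?thesis using that[of p "fst (fs ! i)" b "fst (fs ! j)" b' R] p i j by simp
qed

lemma total_split_weight_zero:
  assumes k: "k = SDotted \<or> k = TDotted"
    and range: "\<forall>(l, a, b)\<in>set es. a < 3 \<and> b < 3" and x: "x < 3"
  shows "total_split_weight k x es = 0"
proof (cases "\<exists>fs\<in>set (reattachments x 3 es). weight k (4, fs @ [(Solid, x, 3)]) \<noteq> 0")
  case True
  then obtain fs where fs: "fs \<in> set (reattachments x 3 es)" "weight k (4, fs @ [(Solid, x, 3)]) \<noteq> 0" by blast
  obtain p b l b' l' R where *: "p \<noteq> x" "p < 3" "l = Solid \<longrightarrow> b = (k = SDotted)"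
    "l' = Solid \<longrightarrow> b' = (k = SDotted)" "mset es = mset (edge_to b l p x # edge_to b' l' p x # R)"
    by (rule parallel_pair[OF k range x fs])
  have "(total_split_weight k x es = 0) = (total_split_weight k x (edge_to b l p x # edge_to b' l' p x # R) = 0)"
  proof (rule adjacent_swaps_mset[OF *(5)])
    fix us e f vs
    show "(total_split_weight k x (us @ e # f # vs) = 0) = (total_split_weight k x (us @ f # e # vs) = 0)"
      unfolding total_split_weight_swap[OF k, of x us e f vs] by simp
  qed
  then show ?thesis using total_split_weight_parallel[OF k *(1)] * by simp
next
  case False
  then have "split_weight k x fs = 0" if "fs \<in> set (reattachments x 3 es)" for fs
    using that by (auto simp: split_weight_def)
  then have "total_split_weight k x es = (\<Sum>fs\<leftarrow>reattachments x 3 es. 0)"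
    unfolding total_split_weight_def by (intro arg_cong[where f = sum_list] map_cong) auto
  then show ?thesis by simp
qed

lemma pairing_diff_V:
  assumes k: "k = SDotted \<or> k = TDotted" and range: "\<forall>(l, a, b)\<in>set es. a < n \<and> b < n"
  shows "pairing (weight k) (diff_V (n, es)) = (0 :: 'k::field_char_0)"
proof (cases "n = 3")
  case True
  have "pairing (weight k) (diff_V (n, es)) = (\<Sum>x<3. of_int (total_split_weight k x es) :: 'k)"
    unfolding diff_V_split_term total_split_weight_def True
    by (simp add: pairing.sum sum_list_hom[of "pairing (weight k)"] sum_list_hom[of of_int] pairing.zero
        pairing.add comp_def split_term_def split_weight_def if_distrib cong: if_cong)
  also have "\<dots> = 0" using total_split_weight_zero[OF k] range True by (simp add: sum.neutral)
  finally show ?thesis .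
next
  case False
  have "pairing (weight k) (split_term n x fs) = (0 :: 'k)" for x fs
    using False by (simp add: split_term_def weight.simps pairing.zero)
  then show ?thesis
    unfolding diff_V_split_term
    by (simp add: pairing.sum sum_list_hom[of "pairing (weight k)"] pairing.zero pairing.add comp_def)
qed


section \<open>The weight on edge replacements\<close>

text \<open>
  The expansion of the vanishing determinant of size five whose rows are the unit vectors for
  \<open>a, b, c, d\<close> and the vector \<open>(1, 1, 1, 1)\<close>, each extended by its sum of coordinates. This last column
  has the entries \<open>1, 1, 1, 1, 4\<close>. It is checked on all values.
\<close>

lemma rooted_sign_expansion:
  assumes "a < 4" "b < 4" "c < 4" "d < 4"
  shows "rooted_sign [a, b, c] - rooted_sign [a, b, d] + rooted_sign [a, c, d] - rooted_sign [b, c, d] =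
    4 * list_sign [a, b, c, d]"
proof -
  have "\<forall>a\<in>{0,1,2,3}. \<forall>b\<in>{0,1,2,3}. \<forall>c\<in>{0,1,2,3}. \<forall>d\<in>{0,1,2,3}.
    (\<Sum>r\<leftarrow>[0,1,2,3]. list_sign [a, b, c, r]) - (\<Sum>r\<leftarrow>[0,1,2,3]. list_sign [a, b, d, r]) +
    (\<Sum>r\<leftarrow>[0,1,2,3]. list_sign [a, c, d, r]) - (\<Sum>r\<leftarrow>[0,1,2,3]. list_sign [b, c, d, r]) = 4 * list_sign [a, b, c, d]"
    by code_simp
  moreover have "rooted_sign us = (\<Sum>r\<leftarrow>[0,1,2,3]. list_sign (us @ [r]))" for us
    by (simp add: rooted_sign_def numeral_eq_Suc)
  moreover have "x \<in> {0,1,2,3}" if "x < 4" for x :: nat using that by auto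
  ultimately show ?thesis using assms by (simp only: append.simps)
qed

text \<open>
  The coefficient of the edge of kind \<open>k\<close> in the differential of a solid edge.
\<close>

definition kind_sign :: "edge_kind \<Rightarrow> int" where
  "kind_sign k = (if k = SDotted then - 1 else 1)"

lemma pairing_diff_edge_nonzero:
  assumes k: "k = SDotted \<or> k = TDotted"
    and nz: "pairing (weight k) (diff_edge n xs e ys) \<noteq> (0 :: 'k::field_char_0)"
  shows "n = 4" "length (xs @ e # ys) = 6" "length (of_kind Solid (xs @ e # ys)) = 4"
    "length (of_kind k (xs @ e # ys)) = 2" "on_four (xs @ e # ys)"
proof -
  obtain l a b where e: "e = (l, a, b)" by (cases e) auto
  have other: "weight k (n, xs @ (l', a, b) # ys) = 0" if "l' \<noteq> Solid" "l' \<noteq> k" for l'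
    using weight_other_kind[of "(l', a, b)" _ k n] that k by auto
  have l: "l = Solid" and "weight k (n, xs @ (k, a, b) # ys) \<noteq> 0"
    using nz k other[of SDotted] other[of TDotted] other[of Wavy]
    by (cases l; auto simp: e pairing.diff pairing.zero)+
  with k show "n = 4" "length (xs @ e # ys) = 6" "length (of_kind Solid (xs @ e # ys)) = 4"
    "length (of_kind k (xs @ e # ys)) = 2" "on_four (xs @ e # ys)"
    using weight_nonzeroD(1-5)[of k n "xs @ (k, a, b) # ys"] by (auto simp: e)
qed

lemma pairing_diff_E_nonzero:
  assumes k: "k = SDotted \<or> k = TDotted"
    and nz: "pairing (weight k) (diff_E (n, es)) \<noteq> (0 :: 'k::field_char_0)"
  shows "n = 4" "length es = 6" "length (of_kind Solid es) = 4" "length (of_kind k es) = 2" "on_four es"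
proof -
  obtain i where i: "i < length es" and
    "pairing (weight k) (diff_edge n (take i es) (es ! i) (drop (Suc i) es)) \<noteq> (0 :: 'k)"
    using nz by (force simp: diff_E.simps pairing.sum pairing.scale intro: sum.neutral)
  with pairing_diff_edge_nonzero[OF k this(2)] id_take_nth_drop[OF i]
  show "n = 4" "length es = 6" "length (of_kind Solid es) = 4" "length (of_kind k es) = 2" "on_four es"
    by metis+
qed

text \<open>
  Replacing the \<open>i\<close>-th solid edge omits its marked end from the first factor and moves its code past
  the later solid edges in the second one. The resulting alternating sum of rooted signs is the
  expansion above.
\<close>

lemma pairing_diff_E_tetrahedron:
  assumes k: "k = SDotted \<or> k = TDotted"
    and kinds: "fst s1 = Solid" "fst s2 = Solid" "fst s3 = Solid" "fst s4 = Solid" "fst d1 = k" "fst d2 = k"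
    and on: "on_four [s1, s2, s3, s4, d1, d2]"
  shows "pairing (weight k) (diff_E (4, [s1, s2, s3, s4, d1, d2])) =
    (of_int (kind_sign k * 4 * list_sign (map (marked_end k) [s1, s2, s3, s4]) *
       list_sign (map edge_code [s1, s2, s3, s4, d1, d2])) :: 'k::field_char_0)"
proof -
  have k_Solid: "k \<noteq> Solid" using k by auto
  let ?m = "marked_end k" and ?c = edge_code
  have replace: "pairing (weight k) (diff_edge 4 xs e ys) =
      (of_int (kind_sign k * weight k (4, xs @ (k, snd e) # ys)) :: 'k)" if "fst e = Solid" for xs e ys
  proof -
    obtain a b where e: "e = (Solid, a, b)" using \<open>fst e = Solid\<close> by (cases e) auto
    have "weight k (4, xs @ (l', a, b) # ys) = 0" if "l' \<noteq> Solid" "l' \<noteq> k" for l'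
      using weight_other_kind[of "(l', a, b)" _ k 4] that k_Solid by auto
    with k show ?thesis by (auto simp: e pairing.diff kind_sign_def)
  qed
  have wavy: "pairing (weight k) (diff_edge 4 xs e ys) = (0 :: 'k)" if "fst e = k" for xs e ys
    using pairing_diff_edge_nonzero(3)[OF k, of 4 xs e ys] weight_other_kind[of "(Wavy, snd e)" _ k 4] k that
    by (cases e) auto
  have code: "?c (k, snd e) = ?c e" for e by (cases e) (simp add: edge_code_def)
  have dots: "\<not> dotted s1" "\<not> dotted s2" "\<not> dotted s3" "\<not> dotted s4" using kinds by (auto simp: dotted_iff)
  have four: "on_four (zs @ (l, snd e) # ys) \<longleftrightarrow> on_four (zs @ e # ys)" for zs l e ys
    by (cases e) simp
  have ons: "on_four [(k, snd s1), s2, s3, s4, d1, d2]" "on_four [s1, (k, snd s2), s3, s4, d1, d2]"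
    "on_four [s1, s2, (k, snd s3), s4, d1, d2]" "on_four [s1, s2, s3, (k, snd s4), d1, d2]"
    using on four[of "[]" k s1 "[s2, s3, s4, d1, d2]"] four[of "[s1]" k s2 "[s3, s4, d1, d2]"]
      four[of "[s1, s2]" k s3 "[s4, d1, d2]"] four[of "[s1, s2, s3]" k s4 "[d1, d2]"] by simp_all
  let ?A = "list_sign (map ?c [s1, s2, s3, s4, d1, d2])"
  have W4: "weight k (4, [s1, s2, s3, (k, snd s4), d1, d2]) = rooted_sign [?m s1, ?m s2, ?m s3] * ?A"
    using ons(4) kinds k_Solid by (simp add: weight.simps code)
  have W3: "weight k (4, [s1, s2, (k, snd s3), s4, d1, d2]) = - rooted_sign [?m s1, ?m s2, ?m s4] * ?A"
    using ons(3) kinds k_Solid list_sign_swap[of "[?c s1, ?c s2]" "?c s4" "?c s3" "[?c d1, ?c d2]"]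
    by (simp add: weight.simps code del: list_sign.simps)
  have W2: "weight k (4, [s1, (k, snd s2), s3, s4, d1, d2]) = rooted_sign [?m s1, ?m s3, ?m s4] * ?A"
    using ons(2) kinds k_Solid list_sign_swap[of "[?c s1, ?c s3]" "?c s4" "?c s2" "[?c d1, ?c d2]"]
      list_sign_swap[of "[?c s1]" "?c s3" "?c s2" "[?c s4, ?c d1, ?c d2]"]
    by (simp add: weight.simps code del: list_sign.simps)
  have W1: "weight k (4, [(k, snd s1), s2, s3, s4, d1, d2]) = - rooted_sign [?m s2, ?m s3, ?m s4] * ?A"
    using ons(1) kinds k_Solid list_sign_swap[of "[?c s2, ?c s3]" "?c s4" "?c s1" "[?c d1, ?c d2]"]
      list_sign_swap[of "[?c s2]" "?c s3" "?c s1" "[?c s4, ?c d1, ?c d2]"]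
      list_sign_swap[of "[]" "?c s2" "?c s1" "[?c s3, ?c s4, ?c d1, ?c d2]"]
    by (simp add: weight.simps code del: list_sign.simps)
  have "pairing (weight k) (diff_E (4, [s1, s2, s3, s4, d1, d2])) =
      (of_int (kind_sign k * (weight k (4, [(k, snd s1), s2, s3, s4, d1, d2]) +
        weight k (4, [s1, (k, snd s2), s3, s4, d1, d2]) + weight k (4, [s1, s2, (k, snd s3), s4, d1, d2]) +
        weight k (4, [s1, s2, s3, (k, snd s4), d1, d2]))) :: 'k)"
    using dots kinds
    by (simp add: diff_E_segment pairing.add pairing.scale pairing.zero replace wavy algebra_simps)
  also have "weight k (4, [(k, snd s1), s2, s3, s4, d1, d2]) +
        weight k (4, [s1, (k, snd s2), s3, s4, d1, d2]) + weight k (4, [s1, s2, (k, snd s3), s4, d1, d2]) +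
        weight k (4, [s1, s2, s3, (k, snd s4), d1, d2]) =
      (rooted_sign [?m s1, ?m s2, ?m s3] - rooted_sign [?m s1, ?m s2, ?m s4] +
       rooted_sign [?m s1, ?m s3, ?m s4] - rooted_sign [?m s2, ?m s3, ?m s4]) * ?A"
    unfolding W1 W2 W3 W4 by (simp add: algebra_simps del: list_sign.simps)
  also have "\<dots> = 4 * list_sign [?m s1, ?m s2, ?m s3, ?m s4] * ?A"
  proof -
    have "?m e < 4" if "e \<in> set [s1, s2, s3, s4, d1, d2]" for e
      using on that unfolding on_four_def by (cases e) fastforce
    then show ?thesis by (subst rooted_sign_expansion) (simp_all del: list_sign.simps)
  qed
  finally show ?thesis by (simp only: list.map mult.assoc)
qed


section \<open>The weight is a cocycle\<close>

lemma admissible_swap: "admissible (n, us @ e # f # vs) \<longleftrightarrow> admissible (n, us @ f # e # vs)"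
proof -
  have "adjacency (us @ e # f # vs) = adjacency (us @ f # e # vs)" by (auto simp: adjacency_def)
  then show ?thesis by (auto simp: admissible.simps valence_swap[of us e])
qed

lemma admissible_reorder: "mset es = mset es' \<Longrightarrow> admissible (n, es) \<longleftrightarrow> admissible (n, es')"
  by (erule adjacent_swaps_mset) (rule admissible_swap)

text \<open>
  Up to sign, the two graphs agree modulo \<open>Z3\<close>, which the differential maps to \<open>Z3\<close>.
\<close>

lemma pairing_differential_reorder:
  assumes k: "k = SDotted \<or> k = TDotted" and adm: "admissible (n, es)" and "mset es = mset es'"
  shows "pairing (weight k) (differential (gr (n, es))) = (0 :: 'k::field_char_0) \<longleftrightarrow>
    pairing (weight k) (differential (gr (n, es'))) = (0 :: 'k)"
proof -
  let ?\<Phi> = "\<lambda>es. pairing (weight k) (differential (gr (n, es))) :: 'k"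
  have step: "?\<Phi> (us @ e # f # vs) = swap_sign e f * ?\<Phi> (us @ f # e # vs)"
    if "admissible (n, us @ e # f # vs)" for us e f vs
  proof -
    have "gr (n, us @ e # f # vs) - smul (swap_sign e f) (gr (n, us @ f # e # vs)) \<in> (Z3 :: 'k chain set)"
      using orient_swap[OF that, where ?'a = 'k] chain.span_mono[of relators "relators \<union> _"]
      unfolding orient_equiv_def Z3_def by blast
    from pairing_weight_Z3[OF differential_Z3[OF this] k] show ?thesis
      by (simp add: differential.diff differential.scale pairing.diff pairing.scale)
  qed
  have "(admissible (n, es) \<and> ?\<Phi> es = 0) \<longleftrightarrow> (admissible (n, es') \<and> ?\<Phi> es' = 0)"
  proof (rule adjacent_swaps_mset[OF assms(3)])
    fix us e f vs
    show "(admissible (n, us @ e # f # vs) \<and> ?\<Phi> (us @ e # f # vs) = 0) \<longleftrightarrow>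
        (admissible (n, us @ f # e # vs) \<and> ?\<Phi> (us @ f # e # vs) = 0)"
      using step[of us e f vs] admissible_swap[of n us e f vs] by (auto simp: swap_sign_def split: if_splits)
  qed
  then show ?thesis using adm admissible_reorder[OF assms(3)] by blast
qed

lemma pairing_differential:
  assumes "k = SDotted \<or> k = TDotted" and "admissible (n, es)"
  shows "pairing (weight k) (differential (gr (n, es))) = (pairing (weight k) (diff_E (n, es)) :: 'k::field_char_0)"
  using assms pairing_diff_V[OF assms(1), of es n] by (auto simp: differential_gr pairing.add admissible.simps)

lemma mset_of_kinds:
  assumes "k \<noteq> Solid" "\<And>e. e \<in> set es \<Longrightarrow> fst e = Solid \<or> fst e = k"
  shows "mset (of_kind Solid es @ of_kind k es) = mset es"
  using assms(2)
proof (induction es)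
  case (Cons e es)
  then have "mset (of_kind Solid es @ of_kind k es) = mset es" "fst e = Solid \<or> fst e = k" by auto
  then show ?case using assms(1) by auto
qed simp

text \<open>
  Only graphs with four solid edges and two edges of kind \<open>k\<close> need to be considered. Such a graph can be
  in the subcomplex only by having a solid target (for \<open>SDotted\<close>) or a solid source (for \<open>TDotted\<close>),
  that is, a vertex that is no marked end. Then the four marked ends cannot be distinct.
\<close>

lemma pairing_differential_st_graph:
  assumes k: "k = SDotted \<or> k = TDotted" and adm: "admissible (n, es)" and st: "st_graph (n, es)"
  shows "pairing (weight k) (differential (gr (n, es))) = (0 :: 'k::field_char_0)"
proof (rule ccontr)
  assume nz: "pairing (weight k) (differential (gr (n, es))) \<noteq> (0 :: 'k)"
  have k_Solid: "k \<noteq> Solid" using k by auto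
  note counts = pairing_diff_E_nonzero[OF k nz[unfolded pairing_differential[OF k adm]]]
  have kinds: "fst e = Solid \<or> fst e = k" if "e \<in> set es" for e
    using length_of_kinds(2)[OF k_Solid that] counts by auto
  obtain s1 s2 s3 s4 where s: "of_kind Solid es = [s1, s2, s3, s4]"
    using counts(3) by (auto simp: numeral_eq_Suc length_Suc_conv)
  obtain d1 d2 where d: "of_kind k es = [d1, d2]"
    using counts(4) by (auto simp: numeral_eq_Suc length_Suc_conv)
  let ?es = "[s1, s2, s3, s4, d1, d2]"
  have reorder: "mset es = mset ?es" using mset_of_kinds[of k es, OF k_Solid kinds] s d by simp
  have adm': "admissible (n, ?es)" using adm admissible_reorder[OF reorder] by blast
  have "pairing (weight k) (diff_E (4, ?es)) \<noteq> (0 :: 'k)"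
    using nz pairing_differential_reorder[OF k adm reorder, where ?'k = 'k]
      pairing_differential[OF k adm', where ?'k = 'k] counts(1) by simp
  have set_es: "set es = set ?es" using reorder mset_eq_setD by blast
  have s_kinds: "set [s1, s2, s3, s4] \<subseteq> {e \<in> set es. fst e = Solid}"
    unfolding s[symmetric] by (auto simp: of_kind_def)
  obtain x where x: "x < 4" "\<forall>e\<in>set es. fst e = Solid \<longrightarrow> marked_end k e \<noteq> x"
  proof -
    have "\<not> has_kind Wavy es" "\<not> (has_kind SDotted es \<and> has_kind TDotted es)"
      using kinds k unfolding has_kind_def by fastforce+
    moreover have "k = SDotted \<Longrightarrow> \<not> has_kind TDotted es" "k = TDotted \<Longrightarrow> \<not> has_kind SDotted es"
      using kinds unfolding has_kind_def by fastforce+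
    ultimately have "if k = SDotted then \<exists>x<n. solid_target es x else \<exists>x<n. solid_source es x"
      using st k by auto
    then show ?thesis
      using that k counts(1) by (fastforce simp: solid_target_def solid_source_def split: if_splits)
  qed
  have m: "marked_end k e \<noteq> x" if "e \<in> set [s1, s2, s3, s4]" for e using x(2) s_kinds that by blast
  have on: "on_four ?es" using counts(5) set_es by (simp add: on_four_def)
  have "marked_end k e < 4" if "e \<in> set ?es" for e
    using on that unfolding on_four_def by (cases e) fastforce
  with m have "set (map (marked_end k) [s1, s2, s3, s4]) \<subseteq> {..<4} - {x}" by auto
  then have "card (set (map (marked_end k) [s1, s2, s3, s4])) \<le> card ({..<4} - {x})"
    by (intro card_mono) auto
  also have "\<dots> = 3" using x(1) by simp
  finally have "card (set (map (marked_end k) [s1, s2, s3, s4])) \<noteq> length (map (marked_end k) [s1, s2, s3, s4])"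
    by simp
  then have "\<not> distinct (map (marked_end k) [s1, s2, s3, s4])" using distinct_card by blast
  then have "list_sign (map (marked_end k) [s1, s2, s3, s4]) = 0" using list_sign_nonzero_iff by blast
  moreover have "fst s1 = Solid" "fst s2 = Solid" "fst s3 = Solid" "fst s4 = Solid" using s_kinds by auto
  moreover have "set [d1, d2] \<subseteq> {e. fst e = k}" unfolding d[symmetric] by (auto simp: of_kind_def)
  then have "fst d1 = k" "fst d2 = k" by auto
  ultimately have "pairing (weight k) (diff_E (4, ?es)) = (0 :: 'k)"
    using pairing_diff_E_tetrahedron[OF k _ _ _ _ _ _ on, where ?'k = 'k] by simp
  then show False using \<open>pairing (weight k) (diff_E (4, ?es)) \<noteq> 0\<close> by blast
qed


section \<open>Boundaries in the quotient\<close>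

lemma diff_hat_Z3: "diff_hat (Z3 :: 'k::field_char_0 chain set) = Z3"
proof
  show "diff_hat Z3 \<subseteq> (Z3 :: 'k chain set)"
    by (auto simp: diff_hat_def set_plus_def intro: Z3_add differential_Z3)
  show "(Z3 :: 'k chain set) \<subseteq> diff_hat Z3"
  proof
    fix z :: "'k chain" assume "z \<in> Z3"
    moreover have "(0 :: 'k chain) \<in> differential ` Z3"
      using Z3_zero differential.zero by (metis image_eqI)
    ultimately have "0 + z \<in> differential ` Z3 + Z3" by (rule set_plus_intro[rotated])
    then show "z \<in> diff_hat Z3" by (simp add: diff_hat_def)
  qed
qed

lemma coset_Z3: "z \<in> Z3 \<Longrightarrow> z +o Z3 = Z3"
proof (intro set_eqI iffI)
  fix y assume z: "z \<in> Z3"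
  show "y \<in> z +o Z3 \<Longrightarrow> y \<in> Z3" using z by (auto simp: elt_set_plus_def intro: Z3_add)
  assume "y \<in> Z3"
  then have "y - z \<in> Z3" using z by (rule Z3_diff)
  then show "y \<in> z +o Z3" by (auto simp: elt_set_plus_def intro!: bexI[of _ "y - z"])
qed

lemma diff_hat_closed:
  assumes "differential y = 0"
  shows "diff_hat (y +o Z3) = Z3"
proof -
  have "y +o Z3 = (+) y ` Z3" by (auto simp: elt_set_plus_def)
  then have "differential ` (y +o Z3) = differential ` Z3"
    using assms by (simp add: image_image differential.add)
  then show ?thesis using diff_hat_Z3 by (simp add: diff_hat_def)
qed

lemma Z3_in_boundaries: "Z3 \<in> boundaries"
proof -
  have "0 +o Z3 \<in> dGC_hat_st" unfolding dGC_hat_st_def by (intro imageI chain.span_zero)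
  then show ?thesis unfolding boundaries_def using diff_hat_Z3 by (metis image_eqI set_zero_plus2 coset_Z3 Z3_zero)
qed

text \<open>
  A boundary has a representative that is the differential of a combination of graphs of the
  subcomplex; passing to another representative adds elements of \<open>Z3\<close> and their differentials.
\<close>

lemma pairing_boundary:
  assumes k: "k = SDotted \<or> k = TDotted" and "B \<in> boundaries" and "y \<in> B"
  shows "pairing (weight k) y = 0"
proof -
  obtain x where x: "x \<in> chain.span (gr ` {G. admissible G \<and> st_graph G})" and B: "B = diff_hat (x +o Z3)"
    using assms(2) by (auto simp: boundaries_def dGC_hat_st_def)
  then obtain z z' where "z \<in> Z3" "z' \<in> Z3" and y: "y = differential (x + z) + z'"
    using assms(3) by (auto simp: diff_hat_def set_plus_def elt_set_plus_def)
  then have "pairing (weight k) (differential z) = 0" "pairing (weight k) z' = 0"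
    by (auto intro: pairing_weight_Z3[OF _ k] differential_Z3)
  moreover have "pairing (weight k) (differential x) = 0"
    using x
  proof (induction rule: chain.span_induct)
    case base
    show ?case
      by (auto simp: chain.subspace_def differential.add differential.scale differential.zero
          pairing.add pairing.scale pairing.zero)
  next
    case (step x)
    then obtain n es where "x = gr (n, es)" "admissible (n, es)" "st_graph (n, es)"
      by (auto simp del: st_graph.simps)
    then show ?case using pairing_differential_st_graph[OF k] by simp
  qed
  ultimately show ?thesis by (simp add: y differential.add pairing.add)
qed


section \<open>The two tetrahedra\<close>

lemma valence_reorder: "mset es = mset es' \<Longrightarrow> valence es x = valence es' x"
  by (erule adjacent_swaps_mset) (rule valence_swap)

lemma degree_change_kind:
  assumes "l \<in> snd ` set (boundary_kinds k :: ('k::field_char_0 \<times> edge_kind) list)"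
  shows "degree (n, xs @ (l, a, b) # ys) = degree (n, xs @ (k, a, b) # ys) + 1"
  using assms by (cases k) (auto simp: num_kind_def)

lemma degree_reorder: "mset es = mset es' \<Longrightarrow> degree (n, es) = degree (n, es')"
  by (erule adjacent_swaps_mset) (simp add: num_kind_def)

lemma solid_target_Cons_iff:
  "solid_target (xs @ f # ys) x \<longleftrightarrow> (\<forall>(k, a, b)\<in>insert f (set xs \<union> set ys).
     (a = x \<longrightarrow> k = SDotted) \<and> (b = x \<longrightarrow> k = Solid \<or> k = SDotted))"
  by (simp add: solid_target_def)

lemma solid_source_Cons_iff:
  "solid_source (xs @ f # ys) x \<longleftrightarrow> (\<forall>(k, a, b)\<in>insert f (set xs \<union> set ys).
     (a = x \<longrightarrow> k = Solid \<or> k = TDotted) \<and> (b = x \<longrightarrow> k = TDotted))"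
  by (simp add: solid_source_def)

lemma diff_E_in_span:
  assumes "\<And>xs k a b ys l. es = xs @ (k, a, b) # ys \<Longrightarrow>
    l \<in> snd ` set (boundary_kinds k :: ('k::field_char_0 \<times> edge_kind) list) \<Longrightarrow> (n, xs @ (l, a, b) # ys) \<in> V"
  shows "diff_E (n, es) \<in> chain.span (gr ` V :: 'k chain set)"
  unfolding diff_E.simps
proof (intro chain.span_sum chain.span_scale)
  fix i assume "i \<in> {..<length es}"
  then have split: "es = take i es @ es ! i # drop (Suc i) es" by (simp add: id_take_nth_drop)
  obtain k a b where e: "es ! i = (k, a, b)" by (cases "es ! i") auto
  have "gr (n, take i es @ (l, a, b) # drop (Suc i) es) \<in> chain.span (gr ` V :: 'k chain set)"
    if "l \<in> snd ` set (boundary_kinds k :: ('k \<times> edge_kind) list)" for l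
    using assms[of "take i es" k a b "drop (Suc i) es", folded e, OF split that]
    by (intro chain.span_base imageI)
  then show "diff_edge n (take i es) (es ! i) (drop (Suc i) es) \<in> chain.span (gr ` V :: 'k chain set)"
    unfolding e by (cases k) (simp_all add: chain.span_diff chain.span_zero)
qed

text \<open>
  The edges of the two special tetrahedra, which differ in the kind of the dotted edges and in
  the direction of the solid edge at \<open>\<tau>\<close>. In both cases every vertex is the marked end of exactly one
  solid edge.
\<close>

definition tetrahedron :: "edge_kind \<Rightarrow> nat \<Rightarrow> nat \<Rightarrow> nat \<Rightarrow> nat \<Rightarrow> edge list" where
  "tetrahedron k \<tau> m l r =
     [if k = SDotted then (Solid, \<tau>, m) else (Solid, m, \<tau>), (Solid, m, l), (Solid, r, m), (Solid, l, r),
      (k, l, \<tau>), (k, r, \<tau>)]"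

context
  fixes k \<tau> m l r es
  assumes k: "k = SDotted \<or> k = TDotted"
    and corners: "distinct [\<tau>, m, l, r]" "{\<tau>, m, l, r} = {..<4 :: nat}"
    and es: "mset es = mset (tetrahedron k \<tau> m l r)"
begin

lemma corner_iff: "x < 4 \<longleftrightarrow> x = \<tau> \<or> x = m \<or> x = l \<or> x = r"
  using corners(2) by auto

lemma corners_distinct:
  "\<tau> \<noteq> m" "\<tau> \<noteq> l" "\<tau> \<noteq> r" "m \<noteq> l" "m \<noteq> r" "l \<noteq> r"
  "m \<noteq> \<tau>" "l \<noteq> \<tau>" "r \<noteq> \<tau>" "l \<noteq> m" "r \<noteq> m" "r \<noteq> l"
  using corners(1) by auto

lemma set_es: "set es = set (tetrahedron k \<tau> m l r)" and distinct_es: "distinct es"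
proof -
  show "set es = set (tetrahedron k \<tau> m l r)" using es by (rule mset_eq_setD)
  have "distinct (tetrahedron k \<tau> m l r)" using k corners(1) by (auto simp: tetrahedron_def)
  then show "distinct es" using es mset_eq_imp_distinct_iff by blast
qed

lemma valence_tetrahedron: "x < 4 \<Longrightarrow> valence es x = 3"
  unfolding valence_reorder[OF es] corner_iff using k
  by (elim disjE) (simp_all add: tetrahedron_def valence_def corners_distinct)

lemma range_tetrahedron: "\<forall>(k, a, b)\<in>set es. a < 4 \<and> b < 4"
  unfolding set_es corner_iff by (auto simp: tetrahedron_def)

lemma admissible_tetrahedron: "admissible (4, es)"
proof -
  have "(a, b) \<in> (adjacency es)\<^sup>*" if "a < 4" "b < 4" for a b
  proof (cases "a = b")
    case False
    then have "(a, b) \<in> adjacency es"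
      using that k unfolding adjacency_def set_es corner_iff
      by (elim disjE) (simp_all add: tetrahedron_def corners_distinct ex_disj_distrib)
    then show ?thesis by (rule r_into_rtrancl)
  qed simp
  then show ?thesis using range_tetrahedron valence_tetrahedron by (simp add: admissible.simps)
qed

lemma degree_tetrahedron: "degree (4, es) = - 1"
  unfolding degree_reorder[OF es] using k by (auto simp: tetrahedron_def num_kind_def)

lemma differential_tetrahedron:
  "differential (gr (4, es)) = (diff_E (4, es) :: 'k::field_char_0 chain)"
  "differential (diff_E (4, es)) = (0 :: 'k chain)"
proof -
  have zero: "diff_V (4, fs) = (0 :: 'k chain)" if "map snd fs = map snd es" for fs
  proof -
    have "admissible (4, fs)" using admissible_tetrahedron admissible_cong_ends[OF that] by simp
    moreover have "valence fs x = valence es x" for x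
    proof -
      have "valence xs x = (\<Sum>(a, b)\<leftarrow>map snd xs. of_bool (a = x) + of_bool (b = x))" for xs :: "edge list"
        by (induction xs) (auto simp: valence_def)
      with that show ?thesis by metis
    qed
    ultimately show ?thesis
      using valence_tetrahedron by (intro diff_V_trivalent) (auto simp: admissible.simps)
  qed
  show "differential (gr (4, es)) = (diff_E (4, es) :: 'k chain)"
    using zero[of es] by (simp add: differential_gr)
  show "differential (diff_E (4, es)) = (0 :: 'k chain)"
    using zero by (rule differential_diff_E)
qed

text \<open>
  A wavy edge suffices, and so do dotted edges of both kinds. If a solid edge becomes an edge of kind \<open>k\<close>,
  its marked end becomes a solid target or a solid source, since it was the marked end of no other
  solid edge.
\<close>

lemma st_graph_replace:
  assumes split: "es = xs @ (j, a, b) # ys"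
    and i: "i \<in> snd ` set (boundary_kinds j :: ('k::field_char_0 \<times> edge_kind) list)"
  shows "st_graph (4, xs @ (i, a, b) # ys)"
proof -
  have j: "(j, a, b) \<in> set es" by (simp add: split)
  have rest: "set xs \<union> set ys = set (tetrahedron k \<tau> m l r) - {(j, a, b)}"
  proof -
    have "set es = insert (j, a, b) (set xs \<union> set ys)" by (simp add: split)
    moreover have "(j, a, b) \<notin> set xs \<union> set ys" using distinct_es by (simp add: split)
    ultimately show ?thesis unfolding set_es by (metis Diff_insert_absorb)
  qed
  have has: "has_kind q (xs @ (i, a, b) # ys) \<longleftrightarrow>
      q = i \<or> (\<exists>c d. (q, c, d) \<in> set (tetrahedron k \<tau> m l r) - {(j, a, b)})" for q
    unfolding has_kind_def rest[symmetric] by auto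
  consider "i = Wavy" | "i \<noteq> k" "i \<noteq> Wavy" | "i = k" by blast
  then show ?thesis
  proof cases
    case 1
    then have "has_kind Wavy (xs @ (i, a, b) # ys)" by (auto simp: has_kind_def)
    then show ?thesis by simp
  next
    case 2
    have "has_kind k (xs @ (i, a, b) # ys)"
      unfolding has using 2 i k j[unfolded set_es] corners(1)
      by (cases j) (auto simp: tetrahedron_def)
    moreover have "i = SDotted \<or> i = TDotted" using i 2 by (cases j) auto
    ultimately show ?thesis using 2 k by (auto simp: has_kind_def)
  next
    case 3
    have "j = Solid" using i 3 k by (cases j) auto
    have "\<exists>x. (x = \<tau> \<or> x = m \<or> x = l \<or> x = r) \<and>
        (if k = SDotted then solid_target (xs @ (i, a, b) # ys) x else solid_source (xs @ (i, a, b) # ys) x)"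
      using k
    proof
      assume "k = SDotted"
      then show ?thesis
        using j[unfolded set_es] corners(1) 3 \<open>j = Solid\<close> unfolding solid_target_Cons_iff solid_source_Cons_iff rest
        by (auto simp: tetrahedron_def)
    next
      assume "k = TDotted"
      then show ?thesis
        using j[unfolded set_es] corners(1) 3 \<open>j = Solid\<close> unfolding solid_target_Cons_iff solid_source_Cons_iff rest
        by (auto simp: tetrahedron_def)
    qed
    moreover have "has_kind k (xs @ (i, a, b) # ys)" using 3 by (auto simp: has_kind_def)
    ultimately show ?thesis using k unfolding corner_iff[symmetric] by (auto split: if_splits)
  qed
qed

lemma alpha_degree: "alpha (4, es) \<in> dGC_hat_st_deg 0"
  unfolding alpha_def dGC_hat_st_deg_def differential_tetrahedron(1)
proof (intro imageI diff_E_in_span CollectI conjI)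
  fix xs j a b ys i
  assume split: "es = xs @ (j, a, b) # ys" and i: "i \<in> snd ` set (boundary_kinds j :: ('a \<times> edge_kind) list)"
  show "admissible (4, xs @ (i, a, b) # ys)"
    using admissible_tetrahedron admissible_change_kind unfolding split by blast
  show "st_graph (4, xs @ (i, a, b) # ys)" using st_graph_replace[OF split i] .
  show "degree (4, xs @ (i, a, b) # ys) = 0"
    using degree_change_kind[OF i] degree_tetrahedron unfolding split by (simp del: degree.simps)
qed

lemma alpha_cycle: "alpha (4, es) \<in> (cycles :: 'k::field_char_0 chain set set)"
proof -
  have "dGC_hat_st_deg 0 \<subseteq> (dGC_hat_st :: 'k chain set set)"
    unfolding dGC_hat_st_deg_def dGC_hat_st_def by (intro image_mono chain.span_mono) auto
  then show ?thesis
    using alpha_degree diff_hat_closed[OF differential_tetrahedron(2)]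
    by (auto simp: cycles_def alpha_def differential_tetrahedron(1))
qed

text \<open>
  Contrary to the graphs of the subcomplex, the four marked ends here are distinct.
\<close>

lemma pairing_tetrahedron:
  "pairing (weight k) (differential (gr (4, es))) \<noteq> (0 :: 'k::field_char_0)"
proof -
  let ?T = "tetrahedron k \<tau> m l r"
  have adm: "admissible (4, ?T)" using admissible_tetrahedron admissible_reorder[OF es] by blast
  have on: "on_four ?T" using corners(1) unfolding on_four_def corner_iff by (auto simp: tetrahedron_def)
  have "set (map ends ?T) \<subseteq> set tetrahedron_edges"
    using on ends_tetrahedron by (fastforce simp: on_four_def)
  moreover have "distinct (map ends ?T)"
    using corners(1) by (auto simp: tetrahedron_def doubleton_eq_iff)
  ultimately have "distinct (map edge_code ?T)"
    unfolding map_edge_code using distinct_tetrahedron_edges(2)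
    by (subst distinct_map) (blast intro: inj_on_subset)
  moreover have "distinct (map (marked_end k) (take 4 ?T))"
    using corners(1) k by (auto simp: tetrahedron_def)
  ultimately have "list_sign (map (marked_end k) (take 4 ?T)) * list_sign (map edge_code ?T) \<noteq> 0"
    using list_sign_nonzero_iff by simp
  moreover have "kind_sign k \<noteq> 0" by (simp add: kind_sign_def)
  ultimately have "kind_sign k * 4 * list_sign (map (marked_end k) (take 4 ?T)) * list_sign (map edge_code ?T) \<noteq> 0"
    by simp
  moreover have "pairing (weight k) (diff_E (4, ?T)) =
      (of_int (kind_sign k * 4 * list_sign (map (marked_end k) (take 4 ?T)) * list_sign (map edge_code ?T)) :: 'k)"
    using pairing_diff_E_tetrahedron[OF k _ _ _ _ _ _ on[unfolded tetrahedron_def], where ?'k = 'k]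
    by (simp add: tetrahedron_def del: list_sign.simps of_int_mult list.map)
  ultimately have "pairing (weight k) (diff_E (4, ?T)) \<noteq> (0 :: 'k)" by (simp only: of_int_eq_0_iff not_False_eq_True)
  then show ?thesis
    using pairing_differential_reorder[OF k admissible_tetrahedron es] pairing_differential[OF k adm] by metis
qed

lemma pairing_tetrahedron_other:
  assumes "k' = SDotted \<or> k' = TDotted" and "k' \<noteq> k"
  shows "pairing (weight k') (differential (gr (4, es))) = (0 :: 'k::field_char_0)"
proof (rule ccontr)
  assume "\<not> ?thesis"
  then have "length (of_kind k' es) = 2"
    using pairing_diff_E_nonzero(4)[OF assms(1)] pairing_differential[OF assms(1) admissible_tetrahedron] by metis
  moreover have "of_kind k' es = []"
    using set_es assms by (auto simp: of_kind_def filter_empty_conv tetrahedron_def)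
  ultimately show False by simp
qed

end

lemma differential_in_alpha: "differential (gr G) \<in> alpha G"
  unfolding alpha_def elt_set_plus_def using Z3_zero by force

theorem theorem8p2p1:
  fixes \<gamma>s \<gamma>t :: graph
    and \<alpha>s \<alpha>t :: "'k::field_char_0 chain set"
  assumes "is_gamma_s \<gamma>s" and "is_gamma_t \<gamma>t"
    and "\<alpha>s = alpha \<gamma>s" and "\<alpha>t = alpha \<gamma>t"
  shows "\<alpha>s \<in> dGC_hat_st_deg 0 \<and> \<alpha>t \<in> dGC_hat_st_deg 0 \<and>
         \<alpha>s \<in> cycles \<and> \<alpha>s \<notin> boundaries \<and>
         \<alpha>t \<in> cycles \<and> \<alpha>t \<notin> boundaries \<and>
         cohomology_class \<alpha>s \<noteq> cohomology_class \<alpha>t"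
proof -
  obtain \<tau> m l r es where s: "distinct [\<tau>, m, l, r]" "{\<tau>, m, l, r} = {..<4}" "\<gamma>s = (4, es)"
    "mset es = mset (tetrahedron SDotted \<tau> m l r)"
    using assms(1) by (auto simp: is_gamma_s_def tetrahedron_def)
  obtain \<tau>' m' l' r' es' where t: "distinct [\<tau>', m', l', r']" "{\<tau>', m', l', r'} = {..<4}" "\<gamma>t = (4, es')"
    "mset es' = mset (tetrahedron TDotted \<tau>' m' l' r')"
    using assms(2) by (auto simp: is_gamma_t_def tetrahedron_def)
  have SD: "SDotted = SDotted \<or> SDotted = TDotted" and TD: "TDotted = SDotted \<or> TDotted = TDotted" by auto
  let ?ds = "differential (gr \<gamma>s) :: 'k chain" and ?dt = "differential (gr \<gamma>t) :: 'k chain"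
  have nz_s: "pairing (weight SDotted) ?ds \<noteq> 0"
    using pairing_tetrahedron[OF SD s(1,2,4)] by (simp add: s(3))
  have nz_t: "pairing (weight TDotted) ?dt \<noteq> 0"
    using pairing_tetrahedron[OF TD t(1,2,4)] by (simp add: t(3))
  have zero_t: "pairing (weight SDotted) ?dt = 0"
    using pairing_tetrahedron_other[OF TD t(1,2,4) SD] by (simp add: t(3))
  have s_nb: "\<alpha>s \<notin> boundaries" using pairing_boundary[OF SD] differential_in_alpha nz_s unfolding assms(3) by blast
  have t_nb: "\<alpha>t \<notin> boundaries" using pairing_boundary[OF TD] differential_in_alpha nz_t unfolding assms(4) by blast
  have "cohomology_class \<alpha>s \<noteq> cohomology_class \<alpha>t"
  proof
    assume eq: "cohomology_class \<alpha>s = cohomology_class \<alpha>t"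
    \<comment> \<open>Adding the zero boundary shows that \<open>\<alpha>s\<close> represents its own class.\<close>
    have "\<alpha>s + Z3 \<in> cohomology_class \<alpha>s"
      unfolding cohomology_class_def using Z3_in_boundaries by (rule set_plus_intro2)
    then obtain B where B: "B \<in> boundaries" "\<alpha>s + Z3 = \<alpha>t + B"
      unfolding eq unfolding cohomology_class_def elt_set_plus_def by auto
    have "?ds + 0 \<in> \<alpha>s + Z3" unfolding assms(3) by (intro set_plus_intro differential_in_alpha Z3_zero)
    then obtain y b where y: "y \<in> \<alpha>t" "b \<in> B" "?ds = y + b" unfolding B(2) by (auto elim: set_plus_elim)
    then obtain z where z: "z \<in> Z3" "y = ?dt + z" by (auto simp: assms(4) alpha_def elt_set_plus_def)
    have "pairing (weight SDotted) ?ds = 0"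
      using pairing_boundary[OF SD B(1) y(2)] pairing_weight_Z3[OF z(1) SD] zero_t by (simp add: y(3) z(2) pairing.add)
    with nz_s show False by contradiction
  qed
  then show ?thesis
    using alpha_degree[OF SD s(1,2,4)] alpha_cycle[OF SD s(1,2,4)] alpha_degree[OF TD t(1,2,4)]
      alpha_cycle[OF TD t(1,2,4)] s_nb t_nb unfolding assms(3,4) s(3) t(3) by blast
qed

end
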